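(* Let $\alpha\in(0,1)$, $T>0$, let $0=t_0<t_1<\dots<t_M=T$ be a temporal mesh, $\tau:=t_1$, and let $\delta_t^\alpha$ be the associated L1 discrete fractional-derivative operator. For $\gamma\in\mathbb{R}$ and $j\ge 1$ set $$\mathcal V^j:=\tau\, t_j^{\alpha-1}\begin{cases}1 & \text{if } \gamma>0,\\ 1+\ln(t_j/\tau) & \text{if } \gamma=0,\\ (\tau/t_j)^{\gamma} & \text{if } \gamma<0,\end{cases}$$ and consider, for real numbers $\{V^j\}_{j=0}^M$, the stability property $$\Big(V^0=0\ \text{ and }\ |\delta_t^\alpha V^j|\lesssim(\tau/t_j)^{\gamma+1}\ \ \forall j\ge1\Big)\ \Longrightarrow\ |V^j|\lesssim\mathcal V^j\ \ \forall j\ge1.\qquad(\mathrm S)$$ (i) Let the temporal mesh be quasi-graded with a parameter $r$ satisfying $1\le r\le(2-\alpha)/\alpha$. Then for any given $\gamma\in\mathbb{R}$ and $\{V^j\}_{j=0}^M$ the property (S) holds true. (ii) If $\gamma\le\alpha-1$, then (S) holds true on an arbitrary temporal mesh $\{t_j\}_{j=0}^M$. (iii) The results (i) and (ii) remain valid if the condition $|\delta_t^\alpha V^j|\lesssim(\tau/t_j)^{\gamma+1}$ in (S) is replaced by $\delta_t^\alpha|V^j|\lesssim(\tau/t_j)^{\gamma+1}$ (i.e. $\delta_t^\alpha$ is applied to the sequence $\{|V^i|\}$).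
   Context: L1 operator: with $\tau_j:=t_j-t_{j-1}$, for a sequence $\{U^j\}_{j=0}^M$ and $m=1,\dots,M$, $$\delta_t^\alpha U^m:=\frac1{\Gamma(1-\alpha)}\sum_{j=1}^m \delta_tU^j\int_{t_{j-1}}^{t_j}(t_m-s)^{-\alpha}\,ds,\qquad \delta_tU^j:=\frac{U^j-U^{j-1}}{\tau_j}.$$ Quasi-graded mesh with parameter $r\ge1$: $$\tau:=t_1\simeq M^{-r},\qquad t_j\simeq\tau j^r,\qquad \tau_j:=t_j-t_{j-1}\simeq\tau^{1/r}t_j^{1-1/r}\qquad\forall j=1,\dots,M.$$ Notation: $a\lesssim b$ means $a\le Cb$ with a generic constant $C>0$ that does not depend on the number $M$ of mesh intervals or on mesh indices (it may depend on fixed data such as $\alpha,T,r,\gamma$ and on the constants implicit in the hypotheses); $a\gtrsim b$ means $b\lesssim a$; $a\simeq b$ means $a\lesssim b$ and $a\gtrsim b$. *)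

theory Defs
  imports "HOL-Analysis.Analysis"
begin

definition temporal_mesh :: "real \<Rightarrow> nat \<Rightarrow> (nat \<Rightarrow> real) \<Rightarrow> bool" where
  "temporal_mesh T M t \<longleftrightarrow> t 0 = 0 \<and> (\<forall>j<M. t j < t (Suc j)) \<and> t M = T"

definition mesh_step :: "(nat \<Rightarrow> real) \<Rightarrow> nat \<Rightarrow> real" where
  "mesh_step t j = t j - t (j - 1)"

text \<open>The two-sided bound \<open>a \<simeq> b\<close>, with the generic constant made explicit.\<close>

definition comparable :: "real \<Rightarrow> real \<Rightarrow> real \<Rightarrow> bool" where
  "comparable K a b \<longleftrightarrow> a \<le> K * b \<and> b \<le> K * a"

text \<open>There is no loss in using the same constant \<open>K\<close> in the three relations: the
  maximum of three admissible constants is admissible for all of them.\<close>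

definition quasi_graded :: "real \<Rightarrow> real \<Rightarrow> nat \<Rightarrow> (nat \<Rightarrow> real) \<Rightarrow> bool" where
  "quasi_graded K r M t \<longleftrightarrow>
     comparable K (t 1) (real M powr (- r)) \<and>
     (\<forall>j\<in>{1..M}. comparable K (t j) (t 1 * real j powr r)) \<and>
     (\<forall>j\<in>{1..M}. comparable K (mesh_step t j) (t 1 powr (1 / r) * t j powr (1 - 1 / r)))"

text \<open>The L1 operator. For \<open>j = m\<close> the integrand is singular at the right end point, where
  \<open>powr\<close> returns 0; this does not affect the integral.\<close>

definition L1_deriv :: "real \<Rightarrow> (nat \<Rightarrow> real) \<Rightarrow> (nat \<Rightarrow> real) \<Rightarrow> nat \<Rightarrow> real" where
  "L1_deriv \<alpha> t U m =
     1 / Gamma (1 - \<alpha>) *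
       (\<Sum>j=1..m. (U j - U (j - 1)) / mesh_step t j *
          integral {t (j - 1)..t j} (\<lambda>s. (t m - s) powr (- \<alpha>)))"

definition V_bound :: "real \<Rightarrow> real \<Rightarrow> (nat \<Rightarrow> real) \<Rightarrow> nat \<Rightarrow> real" where
  "V_bound \<alpha> \<gamma> t j =
     t 1 * t j powr (\<alpha> - 1) *
       (if \<gamma> > 0 then 1
        else if \<gamma> = 0 then 1 + ln (t j / t 1)
        else (t 1 / t j) powr \<gamma>)"

text \<open>Property (S) on a class \<open>\<M>\<close> of meshes \<open>(M, t)\<close>. The constant \<open>C\<close> may depend on
  \<open>\<alpha>\<close>, \<open>\<gamma>\<close>, the class \<open>\<M>\<close> and the constant \<open>C\<^sub>0\<close> in the hypothesis, but neither on
  \<open>M\<close>, on the individual mesh, on the mesh indices, nor on the sequence \<open>V\<close>.\<close>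

definition property_S :: "real \<Rightarrow> real \<Rightarrow> (nat \<times> (nat \<Rightarrow> real)) set \<Rightarrow> bool" where
  "property_S \<alpha> \<gamma> \<M> \<longleftrightarrow>
     (\<forall>C\<^sub>0>0. \<exists>C>0. \<forall>(M, t)\<in>\<M>. \<forall>V :: nat \<Rightarrow> real.
        V 0 = 0 \<and> (\<forall>j\<in>{1..M}. \<bar>L1_deriv \<alpha> t V j\<bar> \<le> C\<^sub>0 * (t 1 / t j) powr (\<gamma> + 1)) \<longrightarrow>
        (\<forall>j\<in>{1..M}. \<bar>V j\<bar> \<le> C * V_bound \<alpha> \<gamma> t j))"

text \<open>The variant of (S) with the one-sided hypothesis on the sequence of absolute values.\<close>

definition property_S_abs :: "real \<Rightarrow> real \<Rightarrow> (nat \<times> (nat \<Rightarrow> real)) set \<Rightarrow> bool" where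
  "property_S_abs \<alpha> \<gamma> \<M> \<longleftrightarrow>
     (\<forall>C\<^sub>0>0. \<exists>C>0. \<forall>(M, t)\<in>\<M>. \<forall>V :: nat \<Rightarrow> real.
        V 0 = 0 \<and> (\<forall>j\<in>{1..M}. L1_deriv \<alpha> t (\<lambda>i. \<bar>V i\<bar>) j \<le> C\<^sub>0 * (t 1 / t j) powr (\<gamma> + 1)) \<longrightarrow>
        (\<forall>j\<in>{1..M}. \<bar>V j\<bar> \<le> C * V_bound \<alpha> \<gamma> t j))"

end

theory Submission
  imports Defs
begin

text \<open>The L1 operator is a weighted sum of the increments of the sequence, and for a fixed level \<open>m\<close>
  the weights, which are averages of the kernel \<open>(t\<^sub>m - s)\<^sup>-\<^sup>\<alpha>\<close> over the mesh intervals, increase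
  towards \<open>t\<^sub>m\<close>. Summation by parts therefore writes it as a positive multiple of the last value
  minus nonnegative multiples of the earlier ones. Two consequences reduce everything to the
  construction of one barrier. The discrete derivative of \<open>\<bar>V\<bar>\<close> is at most the modulus of that of
  \<open>V\<close> (\<open>L1_deriv_abs_le\<close>), so the one-sided version of the stability property implies the other; and
  a comparison principle holds (\<open>L1_deriv_comparison\<close>), so it suffices to find on each mesh a \<open>B\<close>
  with \<open>B\<^sup>0 = 0\<close>, with discrete derivative at least a multiple of \<open>(\<tau> / t\<^sub>j)\<^sup>\<gamma>\<^sup>+\<^sup>1\<close>, and below a
  multiple of the claimed bound.

  For \<open>\<gamma> \<le> \<alpha> - 1\<close> the claimed bound itself, with value 0 at \<open>t\<^sub>0\<close>, is a barrier on any mesh: it is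
  a nonnegative power of \<open>t\<^sub>j\<close>, hence nondecreasing, and all kernel averages are at least
  \<open>t\<^sub>m\<^sup>-\<^sup>\<alpha>\<close>.

  For \<open>\<gamma> > \<alpha> - 1\<close> the starting point is that \<open>s\<^sup>\<alpha>\<^sup>-\<^sup>1\<close> lies in the kernel of the continuous
  fractional derivative. If it is replaced on \<open>[0, \<theta>]\<close> by a linear function vanishing at 0, the
  derivative at \<open>x \<ge> \<theta>\<close> becomes positive, of size \<open>\<theta>\<^sup>\<alpha> x\<^sup>-\<^sup>\<alpha>\<^sup>-\<^sup>1\<close> (\<open>truncated_balance\<close>); this is an exact
  computation, since \<open>s\<^sup>\<alpha>\<^sup>-\<^sup>2 (x - s)\<^sup>-\<^sup>\<alpha>\<close> has an elementary antiderivative. Take \<open>\<theta> = t\<^sub>p\<close>. The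
  discretization error has a part from far back, which is smaller than the main term by the factor
  \<open>(\<tau> / t\<^sub>p)\<^sup>2\<^sup>/\<^sup>r\<close>, and a part from the end of the time interval, of size
  \<open>t\<^sub>m\<^sup>-\<^sup>1 (\<tau> / t\<^sub>m)\<^sup>e\<close> with \<open>e = (2 - \<alpha>) / r\<close>. The second decays in \<open>t\<^sub>m\<close> as fast as the main term
  exactly if \<open>e \<ge> \<alpha>\<close>, which is the restriction on the grading. Both are thus small relative to the
  main term once \<open>p\<close> exceeds a threshold depending on \<open>\<alpha>\<close>, \<open>r\<close> and \<open>K\<close> only
  (\<open>scaled_deriv_after\<close>).

  Finally, these truncated powers are superposed over all \<open>p\<close> beyond the threshold with weights
  \<open>\<tau>\<^sup>\<gamma>\<^sup>+\<^sup>1 \<tau>\<^sub>p t\<^sub>p\<^sup>-\<^sup>\<gamma>\<^sup>-\<^sup>1\<close>, plus one more that handles the first few mesh points. At \<open>t\<^sub>m\<close> the terms with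
  \<open>m / 2 \<le> p \<le> m\<close> already produce the required derivative, all others contributing nonnegatively. The
  sum of the weights up to level \<open>i\<close> is a Riemann sum for \<open>\<tau>\<^sup>\<gamma>\<^sup>+\<^sup>1\<close> times the integral of
  \<open>s\<^sup>-\<^sup>\<gamma>\<^sup>-\<^sup>1\<close> from \<open>\<tau>\<close> to \<open>t\<^sub>i\<close>, and the three cases of this integral are the three cases in the
  claimed bound.\<close>

section \<open>Powers and their integrals against the kernel\<close>

lemma powr_mean_value:
  fixes x y e :: real
  assumes "0 \<le> x" "x < y" "0 < x \<or> 0 < e"
  obtains z where "x < z" "z < y" "y powr e - x powr e = (y - x) * (e * z powr (e - 1))"
proof -
  have "continuous_on {x..y} (\<lambda>s. s powr e)"
    using assms by (intro continuous_on_powr' continuous_intros) auto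
  moreover have D: "((\<lambda>s. s powr e) has_real_derivative e * z powr (e - 1)) (at z)" if "x < z" for z
    using that assms(1) by (intro has_real_derivative_powr) auto
  ultimately obtain l z where z: "x < z" "z < y" "DERIV (\<lambda>s. s powr e) z :> l"
      "y powr e - x powr e = (y - x) * l"
    using MVT[OF assms(2), of "\<lambda>s. s powr e"] by (meson real_differentiable_def)
  with D[OF z(1)] have "l = e * z powr (e - 1)" using DERIV_unique by blast
  with z show ?thesis using that by auto
qed

lemma powr_difference_lower:
  fixes x y \<alpha> :: real
  assumes "0 \<le> x" "x < y" "0 < \<alpha>" "\<alpha> < 1"
  shows "(y - x) * y powr (- \<alpha>) \<le> (y powr (1 - \<alpha>) - x powr (1 - \<alpha>)) / (1 - \<alpha>)"
proof -
  obtain z where z: "x < z" "z < y"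
      "y powr (1 - \<alpha>) - x powr (1 - \<alpha>) = (y - x) * ((1 - \<alpha>) * z powr (1 - \<alpha> - 1))"
    using powr_mean_value[of x y "1 - \<alpha>"] assms by auto
  have "y powr (- \<alpha>) \<le> z powr (- \<alpha>)" using z assms by (intro powr_mono2') auto
  moreover have "(y powr (1 - \<alpha>) - x powr (1 - \<alpha>)) / (1 - \<alpha>) = (y - x) * z powr (- \<alpha>)"
    unfolding z(3) using assms by simp
  ultimately show ?thesis using z assms by (simp add: mult_left_mono)
qed

lemma powr_difference_upper:
  fixes x y \<alpha> :: real
  assumes "0 < x" "x < y" "0 < \<alpha>" "\<alpha> < 1"
  shows "(y powr (1 - \<alpha>) - x powr (1 - \<alpha>)) / (1 - \<alpha>) \<le> (y - x) * x powr (- \<alpha>)"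
proof -
  obtain z where z: "x < z" "z < y"
      "y powr (1 - \<alpha>) - x powr (1 - \<alpha>) = (y - x) * ((1 - \<alpha>) * z powr (1 - \<alpha> - 1))"
    using powr_mean_value[of x y "1 - \<alpha>"] assms by auto
  have "z powr (- \<alpha>) \<le> x powr (- \<alpha>)" using z assms by (intro powr_mono2') auto
  moreover have "(y powr (1 - \<alpha>) - x powr (1 - \<alpha>)) / (1 - \<alpha>) = (y - x) * z powr (- \<alpha>)"
    unfolding z(3) using assms by simp
  ultimately show ?thesis using z assms by (simp add: mult_left_mono)
qed

text \<open>The right end point of an interval gives the lower rectangle for the integral of the decreasing
  function \<open>s\<^sup>-\<^sup>q\<^sup>-\<^sup>1\<close>. All sums of steps times powers of the nodes are bounded by telescoping this
  estimate; negative \<open>q \<ge> - 1\<close> are included because the weights of the final superposition need them.\<close>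

lemma step_times_powr_telescopes:
  fixes x y q :: real
  assumes "0 < x" "x < y" "- 1 \<le> q" "q \<noteq> 0"
  shows "(y - x) * y powr (- q - 1) \<le> (x powr (- q) - y powr (- q)) / q"
proof -
  obtain z where z: "x < z" "z < y"
      "y powr (- q) - x powr (- q) = (y - x) * (- q * z powr (- q - 1))"
    using powr_mean_value[of x y "- q"] assms by auto
  have "(x powr (- q) - y powr (- q)) / q = (y - x) * z powr (- q - 1)"
    using z(3) assms(4) by (simp add: field_simps)
  moreover have "y powr (- q - 1) \<le> z powr (- q - 1)" using z assms by (intro powr_mono2') auto
  ultimately show ?thesis using assms by simp
qed

lemma step_over_endpoint_le_ln:
  fixes x y :: real
  assumes "0 < x" "x < y"
  shows "(y - x) / y \<le> ln y - ln x"
proof -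
  have "ln (x / y) \<le> x / y - 1" using assms by (intro ln_le_minus_one) auto
  then show ?thesis using assms by (simp add: ln_div field_simps)
qed

lemma kernel_has_integral:
  fixes a b c \<alpha> :: real
  assumes "a \<le> b" "b \<le> c" "0 < \<alpha>" "\<alpha> < 1"
  shows "((\<lambda>s. (c - s) powr (- \<alpha>)) has_integral
           ((c - a) powr (1 - \<alpha>) - (c - b) powr (1 - \<alpha>)) / (1 - \<alpha>)) {a..b}"
proof -
  let ?F = "\<lambda>s. - ((c - s) powr (1 - \<alpha>) / (1 - \<alpha>))"
  have "continuous_on {a..b} ?F"
    using assms by (intro continuous_intros continuous_on_powr') auto
  moreover have "(?F has_vector_derivative (c - s) powr (- \<alpha>)) (at s)" if "s \<in> {a<..<b}" for s
  proof -
    have "((\<lambda>s. (c - s) powr (1 - \<alpha>)) has_real_derivative (1 - \<alpha>) * (c - s) powr (- \<alpha>) * (- 1)) (at s)"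
      using that assms by (auto intro!: derivative_eq_intros)
    from DERIV_cmult[OF this, of "- 1 / (1 - \<alpha>)"] show ?thesis
      using assms by (simp add: has_real_derivative_iff_has_vector_derivative)
  qed
  ultimately have "((\<lambda>s. (c - s) powr (- \<alpha>)) has_integral ?F b - ?F a) {a..b}"
    using assms(1) by (intro fundamental_theorem_of_calculus_interior) auto
  then show ?thesis using assms by (simp add: diff_divide_distrib)
qed

text \<open>The factor \<open>(\<alpha> - 1) s\<^sup>\<alpha>\<^sup>-\<^sup>2\<close> is the derivative of \<open>s\<^sup>\<alpha>\<^sup>-\<^sup>1\<close>. That the product has the
  antiderivative \<open>((c - s) / s)\<^sup>1\<^sup>-\<^sup>\<alpha> / c\<close>, vanishing at \<open>s = c\<close>, is what makes
  the fractional derivative of the truncated power computable in closed form.\<close>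

lemma kernel_times_derivative_has_integral:
  fixes a b c \<alpha> :: real
  assumes "0 < a" "a \<le> b" "b \<le> c" "0 < \<alpha>" "\<alpha> < 1"
  shows "((\<lambda>s. (\<alpha> - 1) * s powr (\<alpha> - 2) * (c - s) powr (- \<alpha>)) has_integral
           (c - b) powr (1 - \<alpha>) * b powr (\<alpha> - 1) / c
         - (c - a) powr (1 - \<alpha>) * a powr (\<alpha> - 1) / c) {a..b}"
proof -
  let ?G = "\<lambda>s. (c - s) powr (1 - \<alpha>) * s powr (\<alpha> - 1) / c"
  have "continuous_on {a..b} ?G"
    using assms by (intro continuous_intros continuous_on_powr') auto
  moreover have "(?G has_vector_derivative (\<alpha> - 1) * s powr (\<alpha> - 2) * (c - s) powr (- \<alpha>)) (at s)"
    if s: "s \<in> {a<..<b}" for s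
  proof -
    have pos: "0 < s" "s < c" using s assms by auto
    have e: "(c - s) powr (1 - \<alpha>) = (c - s) * (c - s) powr (- \<alpha>)"
            "s powr (\<alpha> - 1) = s * s powr (\<alpha> - 2)"
      using pos powr_add[of "c - s" 1 "- \<alpha>"] powr_add[of s 1 "\<alpha> - 2"] by auto
    have "(?G has_real_derivative
        ((1 - \<alpha>) * (c - s) powr (1 - \<alpha> - 1) * (- 1) * s powr (\<alpha> - 1)
          + (c - s) powr (1 - \<alpha>) * ((\<alpha> - 1) * s powr (\<alpha> - 1 - 1))) / c) (at s)"
      using pos by (auto intro!: derivative_eq_intros simp: field_simps)
    also have "((1 - \<alpha>) * (c - s) powr (1 - \<alpha> - 1) * (- 1) * s powr (\<alpha> - 1)
          + (c - s) powr (1 - \<alpha>) * ((\<alpha> - 1) * s powr (\<alpha> - 1 - 1))) / c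
        = (\<alpha> - 1) * s powr (\<alpha> - 2) * (c - s) powr (- \<alpha>)"
      using pos unfolding e by (simp add: field_simps)
    finally show ?thesis by (simp add: has_real_derivative_iff_has_vector_derivative)
  qed
  ultimately show ?thesis
    using assms by (intro fundamental_theorem_of_calculus_interior) auto
qed

text \<open>Replacing the derivative \<open>f'\<close> of \<open>f = s\<^sup>\<alpha>\<^sup>-\<^sup>1\<close> by its mean \<open>\<mu>\<close> over the interval changes the
  integral against the kernel \<open>k\<close> only to second order: since \<open>f' - \<mu>\<close> has mean zero, \<open>k\<close> may be
  replaced by \<open>k - k(a)\<close>, so that the increments of both factors enter. A first-order bound
  would leave an error that exceeds the gain from the truncation when \<open>t\<^sub>m\<close> is large against \<open>t\<^sub>p\<close>.\<close>

lemma interpolation_defect: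
  fixes a b c \<alpha> :: real
  assumes "0 < a" "a < b" "b \<le> c" "0 < \<alpha>" "\<alpha> < 1"
  defines "W \<equiv> ((c - a) powr (1 - \<alpha>) - (c - b) powr (1 - \<alpha>)) / (1 - \<alpha>)"
  shows "(c - b) powr (1 - \<alpha>) * b powr (\<alpha> - 1) / c - (c - a) powr (1 - \<alpha>) * a powr (\<alpha> - 1) / c
          - (b powr (\<alpha> - 1) - a powr (\<alpha> - 1)) / (b - a) * W
         \<le> 2 * (b - a) * a powr (\<alpha> - 3) * (W - (b - a) * (c - a) powr (- \<alpha>))"
proof -
  define f' where "f' = (\<lambda>s::real. (\<alpha> - 1) * s powr (\<alpha> - 2))"
  define k where "k = (\<lambda>s. (c - s) powr (- \<alpha>))"
  define \<mu> where "\<mu> = (b powr (\<alpha> - 1) - a powr (\<alpha> - 1)) / (b - a)"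
  define J where "J = (c - b) powr (1 - \<alpha>) * b powr (\<alpha> - 1) / c
                    - (c - a) powr (1 - \<alpha>) * a powr (\<alpha> - 1) / c"
  define D where "D = 2 * (b - a) * a powr (\<alpha> - 3)"
  have I1: "((\<lambda>s. f' s * k s) has_integral J) {a..b}"
    unfolding f'_def k_def J_def using assms by (intro kernel_times_derivative_has_integral) auto
  have I2: "(k has_integral W) {a..b}"
    unfolding k_def W_def using assms by (intro kernel_has_integral) auto
  have I3: "(f' has_integral b powr (\<alpha> - 1) - a powr (\<alpha> - 1)) {a..b}"
  proof (rule fundamental_theorem_of_calculus)
    fix s assume "s \<in> {a..b}"
    then have "((\<lambda>s. s powr (\<alpha> - 1)) has_real_derivative f' s) (at s within {a..b})"
      unfolding f'_def using assms
      by (auto intro!: derivative_eq_intros)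
    then show "((\<lambda>s. s powr (\<alpha> - 1)) has_vector_derivative f' s) (at s within {a..b})"
      by (simp add: has_real_derivative_iff_has_vector_derivative)
  qed (use assms in auto)
  have mu: "b powr (\<alpha> - 1) - a powr (\<alpha> - 1) = \<mu> * (b - a)"
    using assms by (simp add: \<mu>_def)
  have I4: "((\<lambda>s. (f' s - \<mu>) * (k s - k a)) has_integral J - \<mu> * W - k a * (\<mu> * (b - a)) + \<mu> * k a * (b - a)) {a..b}"
  proof -
    have "((\<lambda>s. f' s * k s - \<mu> * k s - k a * f' s + \<mu> * k a) has_integral
        J - \<mu> * W - k a * (\<mu> * (b - a)) + (b - a) *\<^sub>R (\<mu> * k a)) {a..b}"
      using assms I1 I2 I3[unfolded mu]
      by (intro has_integral_add has_integral_diff has_integral_mult_right has_integral_const_real[THEN has_integral_eq_rhs]) auto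
    then show ?thesis by (simp add: algebra_simps)
  qed
  have I5: "((\<lambda>s. D * (k s - k a)) has_integral D * (W - (b - a) * k a)) {a..b}"
    using assms I2
    by (intro has_integral_mult_right has_integral_diff has_integral_const_real[THEN has_integral_eq_rhs]) auto
  have mono: "f' s - \<mu> \<le> D" if s: "a < s" "s < b" for s
  proof -
    obtain z where z: "a < z" "z < b" "b powr (\<alpha> - 1) - a powr (\<alpha> - 1) = (b - a) * ((\<alpha> - 1) * z powr (\<alpha> - 1 - 1))"
      using powr_mean_value[of a b "\<alpha> - 1"] assms by auto
    have "\<mu> = (\<alpha> - 1) * z powr (\<alpha> - 2)" unfolding \<mu>_def z(3) using assms by simp
    moreover have "z powr (\<alpha> - 2) \<le> a powr (\<alpha> - 2)" using z assms by (intro powr_mono2') auto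
    ultimately have m: "(\<alpha> - 1) * a powr (\<alpha> - 2) \<le> \<mu>" using assms by (simp add: mult_left_mono_neg)
    obtain y where y: "a < y" "y < s" "s powr (\<alpha> - 2) - a powr (\<alpha> - 2) = (s - a) * ((\<alpha> - 2) * y powr (\<alpha> - 2 - 1))"
      using powr_mean_value[of a s "\<alpha> - 2"] assms s by auto
    have "(\<alpha> - 1) * s powr (\<alpha> - 2) - (\<alpha> - 1) * a powr (\<alpha> - 2) = (\<alpha> - 1) * (s powr (\<alpha> - 2) - a powr (\<alpha> - 2))"
      by (simp add: algebra_simps)
    also have "\<dots> = ((1 - \<alpha>) * (2 - \<alpha>)) * ((s - a) * y powr (\<alpha> - 3))"
      unfolding y(3) by (simp add: algebra_simps)
    also have "\<dots> \<le> (1 * 2) * ((b - a) * a powr (\<alpha> - 3))"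
      using assms s y by (intro mult_mono powr_mono2') auto
    finally show ?thesis using m by (simp add: f'_def D_def algebra_simps)
  qed
  have k: "k a \<le> k s" if "a < s" "s < b" for s
    unfolding k_def using that assms by (intro powr_mono2') auto
  \<comment> \<open>If \<open>b = c\<close>, then \<open>k b = 0\<close> by the convention for \<open>powr\<close> and \<open>k a \<le> k b\<close> fails; hence the open interval.\<close>
  have "J - \<mu> * W - k a * (\<mu> * (b - a)) + \<mu> * k a * (b - a) \<le> D * (W - (b - a) * k a)"
    using I4 I5 mono k unfolding has_integral_Icc_iff_Ioo
    by (elim has_integral_le) (auto intro!: mult_right_mono)
  then show ?thesis by (simp add: J_def \<mu>_def D_def k_def algebra_simps)
qed

section \<open>The L1 operator as a weighted sum of increments\<close>

text \<open>The mean of \<open>(t\<^sub>m - s)\<^sup>-\<^sup>\<alpha>\<close> over the \<open>j\<close>-th mesh interval, in the closed form that the integral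
  takes for \<open>j \<le> m\<close>.\<close>

definition kernel_avg :: "real \<Rightarrow> (nat \<Rightarrow> real) \<Rightarrow> nat \<Rightarrow> nat \<Rightarrow> real" where
  "kernel_avg \<alpha> t m j =
     ((t m - t (j - 1)) powr (1 - \<alpha>) - (t m - t j) powr (1 - \<alpha>)) / (1 - \<alpha>) / mesh_step t j"

lemma temporal_mesh_less:
  assumes "temporal_mesh T M t" "i < j" "j \<le> M"
  shows "t i < t j"
  using assms(2,3)
proof (induction j)
  case (Suc j)
  then have "t j < t (Suc j)" using assms(1) by (simp add: temporal_mesh_def)
  with Suc show ?case by (cases "i = j") auto
qed simp

lemma temporal_mesh_pos:
  assumes "temporal_mesh T M t" "1 \<le> j" "j \<le> M"
  shows "0 < t j"
  using temporal_mesh_less[OF assms(1), of 0 j] assms by (simp add: temporal_mesh_def)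

lemma temporal_mesh_le:
  assumes "temporal_mesh T M t" "i \<le> j" "j \<le> M"
  shows "t i \<le> t j"
  using temporal_mesh_less[OF assms(1), of i j] assms(2,3) by (cases "i = j") auto

lemma mesh_step_pos:
  assumes "temporal_mesh T M t" "1 \<le> j" "j \<le> M"
  shows "0 < mesh_step t j"
  using temporal_mesh_less[OF assms(1), of "j - 1" j] assms by (simp add: mesh_step_def)

lemma L1_deriv_eq_kernel_avg:
  assumes "temporal_mesh T M t" "m \<le> M" "0 < \<alpha>" "\<alpha> < 1"
  shows "L1_deriv \<alpha> t U m = (\<Sum>j=1..m. (U j - U (j - 1)) * kernel_avg \<alpha> t m j) / Gamma (1 - \<alpha>)"
proof -
  have "integral {t (j - 1)..t j} (\<lambda>s. (t m - s) powr (- \<alpha>))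
      = ((t m - t (j - 1)) powr (1 - \<alpha>) - (t m - t j) powr (1 - \<alpha>)) / (1 - \<alpha>)" if "j \<in> {1..m}" for j
    using that assms temporal_mesh_le[OF assms(1)]
    by (intro integral_unique kernel_has_integral) auto
  then show ?thesis
    unfolding L1_deriv_def kernel_avg_def by (simp add: sum_divide_distrib mult_ac)
qed

lemma kernel_avg_lower:
  assumes "temporal_mesh T M t" "1 \<le> j" "j \<le> m" "m \<le> M" "0 < \<alpha>" "\<alpha> < 1"
  shows "(t m - t (j - 1)) powr (- \<alpha>) \<le> kernel_avg \<alpha> t m j"
proof -
  have "t (j - 1) < t j" "t j \<le> t m"
    using assms temporal_mesh_le[OF assms(1)] temporal_mesh_less[OF assms(1)] by auto
  with powr_difference_lower[of "t m - t j" "t m - t (j - 1)" \<alpha>] assms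
  show ?thesis by (simp add: kernel_avg_def mesh_step_def pos_le_divide_eq mult_ac)
qed

lemma kernel_avg_upper:
  assumes "temporal_mesh T M t" "1 \<le> j" "j < m" "m \<le> M" "0 < \<alpha>" "\<alpha> < 1"
  shows "kernel_avg \<alpha> t m j \<le> (t m - t j) powr (- \<alpha>)"
proof -
  have "t (j - 1) < t j" "t j < t m"
    using assms temporal_mesh_less[OF assms(1)] by auto
  with powr_difference_upper[of "t m - t j" "t m - t (j - 1)" \<alpha>] assms
  show ?thesis by (simp add: kernel_avg_def mesh_step_def pos_divide_le_eq mult_ac)
qed

text \<open>The node \<open>t\<^sub>j\<close> separates two adjacent intervals, so the value of the increasing kernel there
  lies between the two averages.\<close>

lemma kernel_avg_mono:
  assumes "temporal_mesh T M t" "1 \<le> j" "j < m" "m \<le> M" "0 < \<alpha>" "\<alpha> < 1"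
  shows "kernel_avg \<alpha> t m j \<le> kernel_avg \<alpha> t m (Suc j)"
  using kernel_avg_upper[OF assms] kernel_avg_lower[OF assms(1), of "Suc j" m \<alpha>] assms by simp

lemma kernel_avg_pos:
  assumes "temporal_mesh T M t" "1 \<le> j" "j \<le> m" "m \<le> M" "0 < \<alpha>" "\<alpha> < 1"
  shows "0 < kernel_avg \<alpha> t m j"
proof -
  have "t (j - 1) < t m" using assms temporal_mesh_less[OF assms(1), of "j - 1" m] by auto
  then have "0 < (t m - t (j - 1)) powr (- \<alpha>)" by simp
  with kernel_avg_lower[OF assms] show ?thesis by linarith
qed

text \<open>Summation by parts: the coefficients of \<open>U\<^sup>1, \<dots>, U\<^sup>n\<^sup>-\<^sup>1\<close> are the differences
  \<open>w\<^sub>j - w\<^sub>j\<^sub>+\<^sub>1 \<le> 0\<close>, hence these values can only lower the sum if they are nonnegative.\<close>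

lemma weighted_increments_le:
  fixes U w :: "nat \<Rightarrow> real"
  assumes "U 0 = 0" "\<And>i. i < m \<Longrightarrow> 0 \<le> U i" "\<And>j. 1 \<le> j \<Longrightarrow> j < m \<Longrightarrow> w j \<le> w (Suc j)" "1 \<le> n" "n \<le> m"
  shows "(\<Sum>j=1..n. (U j - U (j - 1)) * w j) \<le> U n * w n"
  using assms(4,5)
proof (induction n rule: nat_induct_at_least)
  case base
  then show ?case using assms(1) by simp
next
  case (Suc n)
  have "U n * w n \<le> U n * w (Suc n)"
    using Suc assms(2,3) by (intro mult_left_mono) auto
  with Suc show ?case by (simp add: algebra_simps)
qed

lemma weighted_increments_ge:
  fixes U w :: "nat \<Rightarrow> real"
  assumes "U 0 = 0" "\<And>i. i < m \<Longrightarrow> U i \<le> 0" "\<And>j. 1 \<le> j \<Longrightarrow> j < m \<Longrightarrow> w j \<le> w (Suc j)" "1 \<le> m"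
  shows "U m * w m \<le> (\<Sum>j=1..m. (U j - U (j - 1)) * w j)"
proof -
  have "(\<Sum>j=1..m. (- U j - - U (j - 1)) * w j) \<le> - U m * w m"
    using assms by (intro weighted_increments_le[where m = m]) auto
  moreover have "(\<Sum>j=1..m. (- U j - - U (j - 1)) * w j) = - (\<Sum>j=1..m. (U j - U (j - 1)) * w j)"
    by (simp add: sum_negf[symmetric] algebra_simps)
  ultimately show ?thesis by simp
qed

lemma L1_deriv_add:
  "L1_deriv \<alpha> t (\<lambda>i. U i + V i) m = L1_deriv \<alpha> t U m + L1_deriv \<alpha> t V m"
proof -
  have "(U j + V j - (U (j - 1) + V (j - 1))) / x * y = (U j - U (j - 1)) / x * y + (V j - V (j - 1)) / x * y" for j x y
    by (simp add: algebra_simps diff_divide_distrib add_divide_distrib)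
  then show ?thesis unfolding L1_deriv_def by (simp only: sum.distrib distrib_left)
qed

lemma L1_deriv_cmult:
  "L1_deriv \<alpha> t (\<lambda>i. c * U i) m = c * L1_deriv \<alpha> t U m"
proof -
  have "(c * U j - c * U (j - 1)) / x * y = c * ((U j - U (j - 1)) / x * y)" for j x y
    by (simp add: algebra_simps diff_divide_distrib)
  then have "L1_deriv \<alpha> t (\<lambda>i. c * U i) m = 1 / Gamma (1 - \<alpha>) * (\<Sum>j=1..m. c * ((U j - U (j - 1)) / mesh_step t j *
          integral {t (j - 1)..t j} (\<lambda>s. (t m - s) powr (- \<alpha>))))"
    unfolding L1_deriv_def by (simp only:)
  then show ?thesis unfolding L1_deriv_def sum_distrib_left[symmetric] by (simp only: mult.left_commute)
qed

lemma L1_deriv_diff: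
  "L1_deriv \<alpha> t (\<lambda>i. U i - V i) m = L1_deriv \<alpha> t U m - L1_deriv \<alpha> t V m"
  using L1_deriv_add[of \<alpha> t U "\<lambda>i. (- 1) * V i" m] L1_deriv_cmult[of \<alpha> t "- 1" V m] by simp

lemma L1_deriv_sum:
  "L1_deriv \<alpha> t (\<lambda>i. \<Sum>p\<in>A. U p i) m = (\<Sum>p\<in>A. L1_deriv \<alpha> t (U p) m)"
proof (induction A rule: infinite_finite_induct)
  case (insert x A)
  then have "L1_deriv \<alpha> t (\<lambda>i. \<Sum>p\<in>insert x A. U p i) m = L1_deriv \<alpha> t (\<lambda>i. U x i + (\<Sum>p\<in>A. U p i)) m"
    by (simp only: sum.insert[OF insert.hyps])
  then show ?case using insert by (simp only: L1_deriv_add sum.insert[OF insert.hyps])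
qed (simp_all add: L1_deriv_def)

section \<open>Comparison principle and reduction to barriers\<close>

text \<open>At the first level where \<open>U - B\<close> could be positive all earlier differences are nonpositive, so
  its discrete derivative is at least a positive multiple of the current difference.\<close>

lemma L1_deriv_comparison:
  assumes mesh: "temporal_mesh T M t" and \<alpha>: "0 < \<alpha>" "\<alpha> < 1"
    and le: "\<And>j. 1 \<le> j \<Longrightarrow> j \<le> M \<Longrightarrow> L1_deriv \<alpha> t U j \<le> L1_deriv \<alpha> t B j"
    and zero: "U 0 = 0" "B 0 = 0" and "j \<le> M"
  shows "U j \<le> B j"
  using \<open>j \<le> M\<close>
proof (induction j rule: less_induct)
  case (less m)
  show ?case
  proof (cases "m = 0")
    case False
    define D where "D i = U i - B i" for i
    have gamma: "0 < Gamma (1 - \<alpha>)" using \<alpha> by (intro Gamma_real_pos) auto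
    have "D m * kernel_avg \<alpha> t m m \<le> (\<Sum>j=1..m. (D j - D (j - 1)) * kernel_avg \<alpha> t m j)"
      using False less zero kernel_avg_mono[OF mesh _ _ _ \<alpha>] by (intro weighted_increments_ge) (auto simp: D_def)
    moreover have "L1_deriv \<alpha> t D m \<le> 0"
      using le[of m] False less.prems unfolding D_def L1_deriv_diff by auto
    then have "(\<Sum>j=1..m. (D j - D (j - 1)) * kernel_avg \<alpha> t m j) \<le> 0"
      using L1_deriv_eq_kernel_avg[OF mesh less.prems \<alpha>, of D] gamma
      by (auto simp: divide_le_0_iff)
    moreover have "0 < kernel_avg \<alpha> t m m"
      using False less.prems kernel_avg_pos[OF mesh _ _ _ \<alpha>] by auto
    ultimately have "D m \<le> 0" by (smt (verit) mult_pos_pos)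
    then show ?thesis by (simp add: D_def)
  qed (simp add: zero)
qed

text \<open>With \<open>\<sigma> = sgn V\<^sup>m\<close>, the sequence \<open>\<bar>V\<bar> - \<sigma> V\<close> is nonnegative and vanishes at the levels 0 and \<open>m\<close>,
  so its discrete derivative at level \<open>m\<close> is nonpositive.\<close>

lemma L1_deriv_abs_le:
  assumes mesh: "temporal_mesh T M t" and \<alpha>: "0 < \<alpha>" "\<alpha> < 1"
    and "V 0 = 0" "1 \<le> m" "m \<le> M"
  shows "L1_deriv \<alpha> t (\<lambda>i. \<bar>V i\<bar>) m \<le> \<bar>L1_deriv \<alpha> t V m\<bar>"
proof -
  define U where "U i = \<bar>V i\<bar> - sgn (V m) * V i" for i
  have "0 \<le> U i" for i
    by (auto simp: U_def sgn_if abs_if)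
  then have "(\<Sum>j=1..m. (U j - U (j - 1)) * kernel_avg \<alpha> t m j) \<le> U m * kernel_avg \<alpha> t m m"
    using assms kernel_avg_mono[OF mesh _ _ _ \<alpha>]
    by (intro weighted_increments_le[where m = m]) (auto simp: U_def)
  also have "U m = 0" by (simp add: U_def abs_sgn mult.commute)
  finally have "L1_deriv \<alpha> t U m \<le> 0"
    using \<alpha> L1_deriv_eq_kernel_avg[OF mesh \<open>m \<le> M\<close> \<alpha>, of U] Gamma_real_pos[of "1 - \<alpha>"]
    by (simp add: divide_le_0_iff)
  moreover have "L1_deriv \<alpha> t U m = L1_deriv \<alpha> t (\<lambda>i. \<bar>V i\<bar>) m - sgn (V m) * L1_deriv \<alpha> t V m"
    unfolding U_def L1_deriv_diff L1_deriv_cmult by simp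
  moreover have "sgn (V m) * L1_deriv \<alpha> t V m \<le> \<bar>L1_deriv \<alpha> t V m\<bar>"
    by (auto simp: sgn_if)
  ultimately show ?thesis by linarith
qed

lemma property_S_if_property_S_abs:
  assumes "0 < \<alpha>" "\<alpha> < 1" "\<And>M t. (M, t) \<in> \<M> \<Longrightarrow> temporal_mesh T M t" "property_S_abs \<alpha> \<gamma> \<M>"
  shows "property_S \<alpha> \<gamma> \<M>"
  unfolding property_S_def
proof (intro allI impI)
  fix C\<^sub>0 :: real assume "C\<^sub>0 > 0"
  then obtain C where C: "C > 0" and stable: "\<forall>(M, t)\<in>\<M>. \<forall>V :: nat \<Rightarrow> real.
        V 0 = 0 \<and> (\<forall>j\<in>{1..M}. L1_deriv \<alpha> t (\<lambda>i. \<bar>V i\<bar>) j \<le> C\<^sub>0 * (t 1 / t j) powr (\<gamma> + 1)) \<longrightarrow>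
        (\<forall>j\<in>{1..M}. \<bar>V j\<bar> \<le> C * V_bound \<alpha> \<gamma> t j)"
    using assms(4) unfolding property_S_abs_def by meson
  have "\<forall>j\<in>{1..M}. \<bar>V j\<bar> \<le> C * V_bound \<alpha> \<gamma> t j"
    if Mt: "(M, t) \<in> \<M>" and V: "V 0 = 0" "\<forall>j\<in>{1..M}. \<bar>L1_deriv \<alpha> t V j\<bar> \<le> C\<^sub>0 * (t 1 / t j) powr (\<gamma> + 1)"
    for M t and V :: "nat \<Rightarrow> real"
  proof -
    have "L1_deriv \<alpha> t (\<lambda>i. \<bar>V i\<bar>) j \<le> C\<^sub>0 * (t 1 / t j) powr (\<gamma> + 1)" if "j \<in> {1..M}" for j
      using L1_deriv_abs_le[OF assms(3)[OF Mt] assms(1,2), of V j] V(1) V(2) that by force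
    then show ?thesis using stable Mt V(1) by blast
  qed
  then show "\<exists>C>0. \<forall>(M, t)\<in>\<M>. \<forall>V :: nat \<Rightarrow> real.
        V 0 = 0 \<and> (\<forall>j\<in>{1..M}. \<bar>L1_deriv \<alpha> t V j\<bar> \<le> C\<^sub>0 * (t 1 / t j) powr (\<gamma> + 1)) \<longrightarrow>
        (\<forall>j\<in>{1..M}. \<bar>V j\<bar> \<le> C * V_bound \<alpha> \<gamma> t j)"
    using C by blast
qed

lemma property_S_abs_if_barrier:
  assumes \<alpha>: "0 < \<alpha>" "\<alpha> < 1" and mesh: "\<And>M t. (M, t) \<in> \<M> \<Longrightarrow> temporal_mesh T M t"
    and "c > 0" "D > 0"
    and barrier: "\<And>M t. (M, t) \<in> \<M> \<Longrightarrow> \<exists>B. B 0 = 0 \<and>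
      (\<forall>j\<in>{1..M}. c * (t 1 / t j) powr (\<gamma> + 1) \<le> L1_deriv \<alpha> t B j \<and> B j \<le> D * V_bound \<alpha> \<gamma> t j)"
  shows "property_S_abs \<alpha> \<gamma> \<M>"
  unfolding property_S_abs_def
proof (intro allI impI)
  fix C\<^sub>0 :: real assume C0: "C\<^sub>0 > 0"
  have "\<forall>j\<in>{1..M}. \<bar>V j\<bar> \<le> (C\<^sub>0 / c * D) * V_bound \<alpha> \<gamma> t j"
    if Mt: "(M, t) \<in> \<M>" and V: "V 0 = 0"
      "\<forall>j\<in>{1..M}. L1_deriv \<alpha> t (\<lambda>i. \<bar>V i\<bar>) j \<le> C\<^sub>0 * (t 1 / t j) powr (\<gamma> + 1)"
    for M t and V :: "nat \<Rightarrow> real"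
  proof
    fix j assume j: "j \<in> {1..M}"
    obtain B where B: "B 0 = 0"
      "\<And>j. j \<in> {1..M} \<Longrightarrow> c * (t 1 / t j) powr (\<gamma> + 1) \<le> L1_deriv \<alpha> t B j"
      "\<And>j. j \<in> {1..M} \<Longrightarrow> B j \<le> D * V_bound \<alpha> \<gamma> t j"
      using barrier[OF Mt] by blast
    have "\<bar>V j\<bar> \<le> C\<^sub>0 / c * B j"
    proof (rule L1_deriv_comparison[OF mesh[OF Mt] \<alpha>, where U = "\<lambda>i. \<bar>V i\<bar>"])
      fix i assume i: "1 \<le> i" "i \<le> M"
      have "L1_deriv \<alpha> t (\<lambda>i. \<bar>V i\<bar>) i \<le> C\<^sub>0 * (t 1 / t i) powr (\<gamma> + 1)" using V i by simp
      also have "\<dots> = C\<^sub>0 / c * (c * (t 1 / t i) powr (\<gamma> + 1))" using \<open>c > 0\<close> by simp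
      also have "\<dots> \<le> C\<^sub>0 / c * L1_deriv \<alpha> t B i"
        using B(2)[of i] i C0 \<open>c > 0\<close> by (intro mult_left_mono) auto
      finally show "L1_deriv \<alpha> t (\<lambda>i. \<bar>V i\<bar>) i \<le> L1_deriv \<alpha> t (\<lambda>i. C\<^sub>0 / c * B i) i"
        by (simp only: L1_deriv_cmult)
    qed (use V B j in auto)
    also have "\<dots> \<le> C\<^sub>0 / c * (D * V_bound \<alpha> \<gamma> t j)"
      using B(3)[OF j] C0 \<open>c > 0\<close> by (intro mult_left_mono) auto
    finally show "\<bar>V j\<bar> \<le> (C\<^sub>0 / c * D) * V_bound \<alpha> \<gamma> t j" by (simp only: mult.assoc)
  qed
  moreover have "C\<^sub>0 / c * D > 0" using C0 \<open>c > 0\<close> \<open>D > 0\<close> by simp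
  ultimately show "\<exists>C>0. \<forall>(M, t)\<in>\<M>. \<forall>V :: nat \<Rightarrow> real.
        V 0 = 0 \<and> (\<forall>j\<in>{1..M}. L1_deriv \<alpha> t (\<lambda>i. \<bar>V i\<bar>) j \<le> C\<^sub>0 * (t 1 / t j) powr (\<gamma> + 1)) \<longrightarrow>
        (\<forall>j\<in>{1..M}. \<bar>V j\<bar> \<le> C * V_bound \<alpha> \<gamma> t j)"
    by blast
qed

section \<open>Arbitrary meshes\<close>

text \<open>The barrier is \<open>\<tau>\<^sup>\<gamma>\<^sup>+\<^sup>1 t\<^sub>i\<^sup>p\<close> with \<open>p = \<alpha> - 1 - \<gamma> \<ge> 0\<close>. Its increments are nonnegative and every kernel
  average is at least \<open>t\<^sub>m\<^sup>-\<^sup>\<alpha>\<close>, so the increments may simply be summed.\<close>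

lemma property_S_abs_arbitrary_mesh:
  assumes \<alpha>: "0 < \<alpha>" "\<alpha> < 1" and "\<gamma> \<le> \<alpha> - 1"
    and meshes: "\<And>M t. (M, t) \<in> \<M> \<Longrightarrow> temporal_mesh T M t"
  shows "property_S_abs \<alpha> \<gamma> \<M>"
proof (rule property_S_abs_if_barrier[OF \<alpha> meshes, where c = "1 / Gamma (1 - \<alpha>)" and D = 1])
  fix M t assume "(M, t) \<in> \<M>"
  then have mesh: "temporal_mesh T M t" by (rule meshes)
  define p where "p = \<alpha> - 1 - \<gamma>"
  have p: "0 \<le> p" using assms by (simp add: p_def)
  \<comment> \<open>For \<open>p = 0\<close> this jumps from 0 to 1 in the first step and stays there; the jump then carries the whole derivative.\<close>
  define g where "g i = (if i = 0 then 0 else t i powr p)" for i :: nat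
  define B where "B i = t 1 powr (\<gamma> + 1) * g i" for i
  have g_mono: "g (j - 1) \<le> g j" if "1 \<le> j" "j \<le> M" for j
  proof (cases "j = 1")
    case False
    have "0 < t (j - 1)" "t (j - 1) \<le> t j"
      using that False by (auto intro!: temporal_mesh_pos[OF mesh] temporal_mesh_le[OF mesh])
    then show ?thesis using that p False by (simp add: g_def powr_mono2)
  qed (simp add: g_def)
  have "1 / Gamma (1 - \<alpha>) * (t 1 / t m) powr (\<gamma> + 1) \<le> L1_deriv \<alpha> t B m \<and> B m \<le> 1 * V_bound \<alpha> \<gamma> t m"
    if m: "m \<in> {1..M}" for m
  proof
    have pos: "0 < t 1" "0 < t m" using m temporal_mesh_pos[OF mesh] by auto
    have exponent: "- \<gamma> - 1 = p + - \<alpha>" by (simp add: p_def)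
    have "t m powr (- \<gamma> - 1) = t m powr p * t m powr (- \<alpha>)" unfolding exponent by (rule powr_add)
    also have "\<dots> = g m * t m powr (- \<alpha>)" using m by (simp add: g_def)
    also have "\<dots> = (\<Sum>j=1..m. (g j - g (j - 1)) * t m powr (- \<alpha>))"
      using sum_telescope''[of 0 m g] by (simp add: sum_distrib_right[symmetric] g_def atLeastSucAtMost_greaterThanAtMost[symmetric])
    also have "\<dots> \<le> (\<Sum>j=1..m. (g j - g (j - 1)) * kernel_avg \<alpha> t m j)"
    proof (intro sum_mono mult_left_mono)
      fix j assume j: "j \<in> {1..m}"
      have "t m powr (- \<alpha>) \<le> (t m - t (j - 1)) powr (- \<alpha>)"
        using \<alpha> j m temporal_mesh_less[OF mesh, of "j - 1" m] temporal_mesh_le[OF mesh, of 0 "j - 1"] mesh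
        by (intro powr_mono2') (auto simp: temporal_mesh_def)
      also have "\<dots> \<le> kernel_avg \<alpha> t m j" using j m by (intro kernel_avg_lower[OF mesh _ _ _ \<alpha>]) auto
      finally show "t m powr (- \<alpha>) \<le> kernel_avg \<alpha> t m j" .
      show "0 \<le> g j - g (j - 1)" using g_mono[of j] j m by simp
    qed
    finally have "t m powr (- \<gamma> - 1) / Gamma (1 - \<alpha>) \<le> L1_deriv \<alpha> t g m"
      using \<alpha> m L1_deriv_eq_kernel_avg[OF mesh _ \<alpha>, of m g] Gamma_real_pos[of "1 - \<alpha>"]
      by (simp add: divide_right_mono)
    then have "t 1 powr (\<gamma> + 1) * (t m powr (- \<gamma> - 1) / Gamma (1 - \<alpha>)) \<le> L1_deriv \<alpha> t B m"
      unfolding B_def L1_deriv_cmult by (intro mult_left_mono) auto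
    moreover have "t m powr (- \<gamma> - 1) = 1 / t m powr (\<gamma> + 1)"
    proof -
      have "- \<gamma> - 1 = - (\<gamma> + 1)" by simp
      then show ?thesis by (simp only: powr_minus_divide)
    qed
    ultimately show "1 / Gamma (1 - \<alpha>) * (t 1 / t m) powr (\<gamma> + 1) \<le> L1_deriv \<alpha> t B m"
      using pos by (simp add: powr_divide mult_ac)
    have "V_bound \<alpha> \<gamma> t m = t 1 * t m powr (\<alpha> - 1) * (t 1 / t m) powr \<gamma>"
      using assms by (simp add: V_bound_def)
    also have "\<dots> = B m"
      using m pos by (simp add: B_def g_def p_def powr_divide powr_add powr_diff)
    finally show "B m \<le> 1 * V_bound \<alpha> \<gamma> t m" by simp
  qed
  moreover have "B 0 = 0" by (simp add: B_def g_def)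
  ultimately show "\<exists>B. B 0 = 0 \<and> (\<forall>j\<in>{1..M}. 1 / Gamma (1 - \<alpha>) * (t 1 / t j) powr (\<gamma> + 1) \<le> L1_deriv \<alpha> t B j
      \<and> B j \<le> 1 * V_bound \<alpha> \<gamma> t j)" by blast
qed (use \<alpha> Gamma_real_pos[of "1 - \<alpha>"] in auto)

section \<open>Quasi-graded meshes\<close>

text \<open>The constants below depend on \<open>\<alpha>\<close>, \<open>r\<close> and \<open>K\<close> but not on a mesh. They are defined outside the
  mesh locale because they have to be chosen before the mesh is fixed.\<close>

definition node_ratio_const :: "real \<Rightarrow> real \<Rightarrow> real" where
  "node_ratio_const r K = K\<^sup>2 * 2 powr r"

text \<open>On a quasi-graded mesh the squared step times the second derivative of \<open>s\<^sup>\<alpha>\<^sup>-\<^sup>1\<close> behaves like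
  \<open>\<tau>\<^sup>2\<^sup>/\<^sup>r s\<^sup>-\<^sup>q\<^sup>-\<^sup>1\<close> with this exponent \<open>q\<close>.\<close>

definition decay_exponent :: "real \<Rightarrow> real \<Rightarrow> real" where
  "decay_exponent \<alpha> r = 2 / r - \<alpha>"

definition curvature_const :: "real \<Rightarrow> real \<Rightarrow> real \<Rightarrow> real" where
  "curvature_const \<alpha> r K = 2 * K\<^sup>2 * node_ratio_const r K powr (3 - \<alpha>)"

definition defect_const :: "real \<Rightarrow> real \<Rightarrow> real \<Rightarrow> real" where
  "defect_const \<alpha> r K = 4 * curvature_const \<alpha> r K / decay_exponent \<alpha> r
     + curvature_const \<alpha> r K * 2 powr (decay_exponent \<alpha> r + 1) * (1 + 1 / (1 - \<alpha>)) * K powr \<alpha>"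

locale graded_mesh =
  fixes \<alpha> T r K :: real and M :: nat and t :: "nat \<Rightarrow> real"
  assumes \<alpha>: "0 < \<alpha>" "\<alpha> < 1"
    and r: "1 \<le> r" "r \<le> (2 - \<alpha>) / \<alpha>"
    and M: "1 \<le> M"
    and mesh: "temporal_mesh T M t"
    and graded: "quasi_graded K r M t"
begin

abbreviation "L \<equiv> node_ratio_const r K"
abbreviation "q \<equiv> decay_exponent \<alpha> r"
abbreviation "C\<^sub>1 \<equiv> curvature_const \<alpha> r K"
abbreviation "C\<^sub>2 \<equiv> defect_const \<alpha> r K"

text \<open>This is \<open>min (s t\<^sub>p\<^sup>\<alpha>\<^sup>-\<^sup>2) (s\<^sup>\<alpha>\<^sup>-\<^sup>1)\<close> at the nodes: the null function \<open>s\<^sup>\<alpha>\<^sup>-\<^sup>1\<close> of the fractional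
  derivative, continued linearly to 0 below \<open>t\<^sub>p\<close>. The kink is at a node, so the linear piece is
  represented exactly by interpolation.\<close>

definition barrier :: "nat \<Rightarrow> nat \<Rightarrow> real" where
  "barrier p i = (if i \<le> p then t i * t p powr (\<alpha> - 2) else t i powr (\<alpha> - 1))"

lemma tau_pos: "0 < t 1"
  using M by (intro temporal_mesh_pos[OF mesh]) auto

lemma tau_le: "1 \<le> j \<Longrightarrow> j \<le> M \<Longrightarrow> t 1 \<le> t j"
  by (intro temporal_mesh_le[OF mesh]) auto

lemma node_le: "1 \<le> j \<Longrightarrow> j \<le> M \<Longrightarrow> t j \<le> K * (t 1 * real j powr r)"
  and le_node: "1 \<le> j \<Longrightarrow> j \<le> M \<Longrightarrow> t 1 * real j powr r \<le> K * t j"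
  and step_le: "1 \<le> j \<Longrightarrow> j \<le> M \<Longrightarrow> mesh_step t j \<le> K * (t 1 powr (1 / r) * t j powr (1 - 1 / r))"
  and le_step: "1 \<le> j \<Longrightarrow> j \<le> M \<Longrightarrow> t 1 powr (1 / r) * t j powr (1 - 1 / r) \<le> K * mesh_step t j"
  using graded unfolding quasi_graded_def comparable_def by auto

lemma K_ge_1: "1 \<le> K"
  using node_le[of 1] M tau_pos by simp

lemma L_ge_1: "1 \<le> L"
proof -
  have "1 * 1 \<le> K\<^sup>2 * 2 powr r" using K_ge_1 r by (intro mult_mono ge_one_powr_ge_zero) auto
  then show ?thesis by (simp add: node_ratio_const_def)
qed

text \<open>Because of this sign, the far-back error sums to a quantity governed by its contributions near \<open>t\<^sub>p\<close>.\<close>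

lemma q_pos: "0 < q"
proof -
  have "r * \<alpha> \<le> 2 - \<alpha>" using r \<alpha> by (simp add: field_simps)
  then have "r * \<alpha> < 2" using \<alpha> by linarith
  then show ?thesis using r by (simp add: decay_exponent_def field_simps)
qed

text \<open>Applied with \<open>p = j - 1\<close> for adjacent nodes and with \<open>p \<ge> m / 2\<close> for the upper half of the indices.\<close>

lemma node_ratio:
  assumes "1 \<le> j" "j \<le> 2 * p" "j \<le> M" "1 \<le> p" "p \<le> M"
  shows "t j \<le> L * t p"
proof -
  have "t j \<le> K * (t 1 * real j powr r)" using assms by (intro node_le)
  also have "\<dots> \<le> K * (t 1 * (2 * real p) powr r)"
    using assms K_ge_1 tau_pos r by (intro mult_left_mono powr_mono2) auto
  also have "\<dots> = K * 2 powr r * (t 1 * real p powr r)" by (simp add: powr_mult)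
  also have "\<dots> \<le> K * 2 powr r * (K * t p)"
    using assms K_ge_1 by (intro mult_left_mono le_node) auto
  finally show ?thesis by (simp add: node_ratio_const_def power2_eq_square mult_ac)
qed

lemma tau_over_node_le:
  assumes "1 \<le> p" "p \<le> M"
  shows "t 1 / t p \<le> K * real p powr (- r)"
  using le_node[OF assms] temporal_mesh_pos[OF mesh assms] assms by (simp add: powr_minus field_simps)

text \<open>The relative step \<open>\<tau>\<^sub>p / t\<^sub>p\<close> is at least of order \<open>1 / p\<close>, so the indices between \<open>m / 2\<close> and \<open>m\<close>
  carry a fixed share of any sum of relative steps.\<close>

lemma node_le_step:
  assumes "1 \<le> p" "p \<le> M"
  shows "t p \<le> K powr (1 + 1 / r) * real p * mesh_step t p"
proof -
  have pos: "0 < t p" using temporal_mesh_pos[OF mesh assms] .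
  have "t p powr (1 / r) \<le> (K * (t 1 * real p powr r)) powr (1 / r)"
    using node_le[OF assms] pos r by (intro powr_mono2) auto
  also have "\<dots> = K powr (1 / r) * t 1 powr (1 / r) * real p"
    using K_ge_1 tau_pos r by (simp add: powr_mult powr_powr)
  finally have 1: "t p powr (1 / r) \<le> K powr (1 / r) * t 1 powr (1 / r) * real p" .
  have "t p = t p powr (1 / r) * t p powr (1 - 1 / r)" using pos by (simp add: powr_add[symmetric])
  also have "\<dots> \<le> K powr (1 / r) * t 1 powr (1 / r) * real p * t p powr (1 - 1 / r)"
    using 1 by (intro mult_right_mono) auto
  also have "\<dots> = K powr (1 / r) * real p * (t 1 powr (1 / r) * t p powr (1 - 1 / r))" by simp
  also have "\<dots> \<le> K powr (1 / r) * real p * (K * mesh_step t p)"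
    using le_step[OF assms] by (intro mult_left_mono) auto
  also have "\<dots> = K powr (1 + 1 / r) * real p * mesh_step t p"
    using K_ge_1 by (simp add: powr_add)
  finally show ?thesis .
qed

lemma squared_step_bound:
  assumes "2 \<le> j" "j \<le> M"
  shows "2 * (mesh_step t j)\<^sup>2 * t (j - 1) powr (\<alpha> - 3) \<le> C\<^sub>1 * t 1 powr (2 / r) * t j powr (- q - 1)"
proof -
  have pos: "0 < t j" "0 < t (j - 1)" using temporal_mesh_pos[OF mesh] assms by auto
  have "t j / L \<le> t (j - 1)" using node_ratio[of j "j - 1"] assms L_ge_1 by (simp add: field_simps)
  then have "t (j - 1) powr (\<alpha> - 3) \<le> (t j / L) powr (\<alpha> - 3)"
    using pos L_ge_1 \<alpha> by (intro powr_mono2') auto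
  also have "\<dots> = L powr (3 - \<alpha>) * t j powr (\<alpha> - 3)"
    using pos L_ge_1 powr_minus_divide[of L "3 - \<alpha>"] by (simp add: powr_divide)
  finally have 1: "t (j - 1) powr (\<alpha> - 3) \<le> L powr (3 - \<alpha>) * t j powr (\<alpha> - 3)" .
  have "(mesh_step t j)\<^sup>2 \<le> (K * (t 1 powr (1 / r) * t j powr (1 - 1 / r)))\<^sup>2"
    using step_le[of j] mesh_step_pos[OF mesh, of j] assms by (intro power_mono) auto
  also have "\<dots> = K\<^sup>2 * t 1 powr (2 / r) * t j powr (2 - 2 / r)"
    using pos tau_pos by (simp add: power_mult_distrib powr_power mult.assoc algebra_simps)
  finally have 2: "(mesh_step t j)\<^sup>2 \<le> K\<^sup>2 * t 1 powr (2 / r) * t j powr (2 - 2 / r)" .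
  have "(mesh_step t j)\<^sup>2 * t (j - 1) powr (\<alpha> - 3)
      \<le> (K\<^sup>2 * t 1 powr (2 / r) * t j powr (2 - 2 / r)) * (L powr (3 - \<alpha>) * t j powr (\<alpha> - 3))"
    using 1 2 by (intro mult_mono) auto
  also have "\<dots> = K\<^sup>2 * L powr (3 - \<alpha>) * t 1 powr (2 / r) * (t j powr (2 - 2 / r) * t j powr (\<alpha> - 3))" by simp
  also have "t j powr (2 - 2 / r) * t j powr (\<alpha> - 3) = t j powr (- q - 1)"
    using pos by (simp add: powr_add[symmetric] decay_exponent_def)
  finally show ?thesis by (simp add: curvature_const_def)
qed

lemma C1_pos: "0 < C\<^sub>1"
  using K_ge_1 L_ge_1 by (simp add: curvature_const_def)

section \<open>Discretization error for the null function\<close>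

text \<open>The bound for the discretization error on the \<open>j\<close>-th interval at level \<open>m\<close>. As \<open>kernel_avg\<close> is the
  integral of the kernel divided by the step, the step appears squared.\<close>

definition defect :: "nat \<Rightarrow> nat \<Rightarrow> real" where
  "defect m j = 2 * (mesh_step t j)\<^sup>2 * t (j - 1) powr (\<alpha> - 3)
     * (kernel_avg \<alpha> t m j - (t m - t (j - 1)) powr (- \<alpha>))"

text \<open>The coefficients in the two parts of the error: \<open>far\<close> multiplies a sum dominated by the intervals next
  to \<open>t\<^sub>p\<close>, \<open>near\<close> the total increase of the kernel up to the last interval.\<close>

definition far :: "nat \<Rightarrow> real" where
  "far m = 4 * C\<^sub>1 / q * t 1 powr (2 / r) * t m powr (- \<alpha> - 1)"

definition near :: "nat \<Rightarrow> real" where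
  "near m = C\<^sub>1 * 2 powr (q + 1) * t 1 powr (2 / r) * t m powr (- q - 1)"

lemma near_nonneg: "0 \<le> near m" and far_nonneg: "0 \<le> far m"
  using C1_pos q_pos by (auto simp: near_def far_def)

lemma increment_over_kernel:
  assumes "2 \<le> j" "j \<le> m" "m \<le> M"
  shows "(t j powr (\<alpha> - 1) - t (j - 1) powr (\<alpha> - 1)) * kernel_avg \<alpha> t m j
     \<ge> (t m - t j) powr (1 - \<alpha>) * t j powr (\<alpha> - 1) / t m
      - (t m - t (j - 1)) powr (1 - \<alpha>) * t (j - 1) powr (\<alpha> - 1) / t m - defect m j"
proof -
  have pos: "0 < t (j - 1)" "t (j - 1) < t j" "t j \<le> t m"
    using assms temporal_mesh_pos[OF mesh] temporal_mesh_less[OF mesh] temporal_mesh_le[OF mesh] by auto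
  define W where "W = ((t m - t (j - 1)) powr (1 - \<alpha>) - (t m - t j) powr (1 - \<alpha>)) / (1 - \<alpha>)"
  define s where "s = mesh_step t j"
  have s: "t j - t (j - 1) = s" "s > 0" using pos by (auto simp: s_def mesh_step_def)
  have W: "W = s * kernel_avg \<alpha> t m j" using s by (simp add: W_def kernel_avg_def s_def)
  have "(t m - t j) powr (1 - \<alpha>) * t j powr (\<alpha> - 1) / t m
      - (t m - t (j - 1)) powr (1 - \<alpha>) * t (j - 1) powr (\<alpha> - 1) / t m
      - (t j powr (\<alpha> - 1) - t (j - 1) powr (\<alpha> - 1)) / s * W
      \<le> 2 * s * t (j - 1) powr (\<alpha> - 3) * (W - s * (t m - t (j - 1)) powr (- \<alpha>))"
    using interpolation_defect[OF pos \<alpha>] unfolding W_def s(1) .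
  moreover have "2 * s * t (j - 1) powr (\<alpha> - 3) * (W - s * (t m - t (j - 1)) powr (- \<alpha>)) = defect m j"
    unfolding W defect_def by (simp add: s_def power2_eq_square algebra_simps)
  moreover have "(t j powr (\<alpha> - 1) - t (j - 1) powr (\<alpha> - 1)) / s * W
      = (t j powr (\<alpha> - 1) - t (j - 1) powr (\<alpha> - 1)) * kernel_avg \<alpha> t m j"
    unfolding W using s by simp
  ultimately show ?thesis by linarith
qed

text \<open>Up to \<open>t\<^sub>m / 2\<close> the kernel is smooth and its increment is a step times \<open>t\<^sub>m\<^sup>-\<^sup>\<alpha>\<^sup>-\<^sup>1\<close>, so the power of
  \<open>t\<^sub>j\<close> is telescoped; beyond, the power of \<open>t\<^sub>j\<close> is comparable to that of \<open>t\<^sub>m\<close>, and the kernel is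
  telescoped. Bounding both cases by the sum of the two telescoping terms avoids splitting the sum
  over \<open>j\<close>.\<close>

lemma defect_le:
  assumes "2 \<le> j" "j < m" "m \<le> M"
  shows "defect m j \<le> far m * (t (j - 1) powr (- q) - t j powr (- q))
     + near m * ((t m - t j) powr (- \<alpha>) - (t m - t (j - 1)) powr (- \<alpha>))"
proof -
  define k where "k i = (t m - t i) powr (- \<alpha>)" for i
  define s where "s = mesh_step t j"
  have pos: "0 < t (j - 1)" "t (j - 1) < t j" "t j < t m" "0 < s" "t j - t (j - 1) = s"
    using assms temporal_mesh_pos[OF mesh] temporal_mesh_less[OF mesh] mesh_step_pos[OF mesh]
    by (auto simp: s_def mesh_step_def)
  have k_mono: "k (j - 1) \<le> k j" unfolding k_def using pos \<alpha> by (intro powr_mono2') auto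
  have q_mono: "t j powr (- q) \<le> t (j - 1) powr (- q)" using pos q_pos by (intro powr_mono2') auto
  have "0 \<le> kernel_avg \<alpha> t m j - k (j - 1)"
    unfolding k_def using kernel_avg_lower[OF mesh _ _ _ \<alpha>, of j m] assms by simp
  moreover have "kernel_avg \<alpha> t m j \<le> k j"
    unfolding k_def using assms by (intro kernel_avg_upper[OF mesh _ _ _ \<alpha>]) auto
  ultimately have 1: "defect m j \<le> C\<^sub>1 * t 1 powr (2 / r) * t j powr (- q - 1) * (k j - k (j - 1))"
    unfolding defect_def k_def[symmetric]
    using assms C1_pos by (intro mult_mono squared_step_bound) auto
  show ?thesis
  proof (cases "t j \<le> t m / 2")
    case True
    obtain z where z: "t m - t j < z" "z < t m - t (j - 1)"
       "(t m - t (j - 1)) powr (- \<alpha>) - (t m - t j) powr (- \<alpha>)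
         = (t m - t (j - 1) - (t m - t j)) * (- \<alpha> * z powr (- \<alpha> - 1))"
      using powr_mean_value[of "t m - t j" "t m - t (j - 1)" "- \<alpha>"] pos by auto
    have "k j - k (j - 1) = s * (\<alpha> * z powr (- \<alpha> - 1))"
      using z(3) pos(5) by (simp add: k_def algebra_simps)
    also have "\<dots> \<le> s * (1 * (t m / 2) powr (- \<alpha> - 1))"
      using True z pos \<alpha> by (intro mult_left_mono mult_mono powr_mono2') auto
    also have "(t m / 2) powr (- \<alpha> - 1) = t m powr (- \<alpha> - 1) * 2 powr (\<alpha> + 1)"
      using pos powr_minus_divide[of 2 "\<alpha> + 1"] by (simp add: powr_divide)
    also have "\<dots> \<le> t m powr (- \<alpha> - 1) * 2 powr 2"
      using \<alpha> by (intro mult_left_mono powr_mono) auto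
    finally have 2: "k j - k (j - 1) \<le> s * (4 * t m powr (- \<alpha> - 1))" using pos by simp
    have "s * t j powr (- q - 1) \<le> (t (j - 1) powr (- q) - t j powr (- q)) / q"
      using step_times_powr_telescopes[of "t (j - 1)" "t j" q] pos q_pos by simp
    note 3 = this
    have "defect m j \<le> C\<^sub>1 * t 1 powr (2 / r) * t j powr (- q - 1) * (s * (4 * t m powr (- \<alpha> - 1)))"
      using 1 2 C1_pos by (meson mult_left_mono order_trans mult_nonneg_nonneg powr_ge_zero less_imp_le)
    also have "\<dots> = 4 * C\<^sub>1 * t 1 powr (2 / r) * t m powr (- \<alpha> - 1) * (s * t j powr (- q - 1))" by simp
    also have "\<dots> \<le> 4 * C\<^sub>1 * t 1 powr (2 / r) * t m powr (- \<alpha> - 1) * ((t (j - 1) powr (- q) - t j powr (- q)) / q)"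
      using 3 C1_pos by (intro mult_left_mono) auto
    also have "\<dots> = far m * (t (j - 1) powr (- q) - t j powr (- q))"
      by (simp add: far_def)
    finally show ?thesis
      using near_nonneg[of m] k_mono unfolding k_def by (meson add_increasing2 diff_ge_0_iff_ge mult_nonneg_nonneg)
  next
    case False
    have "t j powr (- q - 1) \<le> (t m / 2) powr (- q - 1)"
      using False pos q_pos by (intro powr_mono2') auto
    also have "\<dots> = 2 powr (q + 1) * t m powr (- q - 1)"
      using pos powr_minus_divide[of 2 "q + 1"] by (simp add: powr_divide)
    finally have "C\<^sub>1 * t 1 powr (2 / r) * t j powr (- q - 1) * (k j - k (j - 1)) \<le>
      C\<^sub>1 * t 1 powr (2 / r) * (2 powr (q + 1) * t m powr (- q - 1)) * (k j - k (j - 1))"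
      using k_mono C1_pos by (intro mult_right_mono mult_left_mono) auto
    also have "\<dots> = near m * (k j - k (j - 1))" by (simp add: near_def)
    finally have "defect m j \<le> near m * (k j - k (j - 1))" using 1 by linarith
    then show ?thesis
      using far_nonneg[of m] q_mono unfolding k_def by (meson add_increasing diff_ge_0_iff_ge mult_nonneg_nonneg)
  qed
qed

text \<open>Next to the singularity the whole kernel average is used, since the kernel has no finite increment
  there. The average is \<open>\<tau>\<^sub>m\<^sup>-\<^sup>\<alpha> / (1 - \<alpha>)\<close>, comparable to the kernel at \<open>t\<^sub>m\<^sub>-\<^sub>1\<close>.\<close>

lemma last_defect_le:
  assumes "2 \<le> m" "m \<le> M"
  shows "defect m m \<le> near m / (1 - \<alpha>) * mesh_step t m powr (- \<alpha>)"
proof -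
  define s where "s = mesh_step t m"
  have pos: "0 < t m" "0 < s" "t m - t (m - 1) = s"
    using assms temporal_mesh_pos[OF mesh] mesh_step_pos[OF mesh] by (auto simp: s_def mesh_step_def)
  have "kernel_avg \<alpha> t m m = s powr (- \<alpha>) / (1 - \<alpha>)"
    using pos powr_add[of s 1 "- \<alpha>"] by (simp add: kernel_avg_def s_def[symmetric])
  note avg = this
  have "defect m m \<le> 2 * (mesh_step t m)\<^sup>2 * t (m - 1) powr (\<alpha> - 3) * kernel_avg \<alpha> t m m"
    unfolding defect_def by (intro mult_left_mono) auto
  also have "\<dots> \<le> C\<^sub>1 * t 1 powr (2 / r) * t m powr (- q - 1) * kernel_avg \<alpha> t m m"
    using assms kernel_avg_pos[OF mesh _ _ _ \<alpha>, of m m] by (intro mult_right_mono squared_step_bound) auto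
  also have "\<dots> \<le> near m * kernel_avg \<alpha> t m m"
  proof (intro mult_right_mono)
    have "C\<^sub>1 * t 1 powr (2 / r) * t m powr (- q - 1) * 1 \<le> C\<^sub>1 * t 1 powr (2 / r) * t m powr (- q - 1) * 2 powr (q + 1)"
      using C1_pos q_pos by (intro mult_left_mono ge_one_powr_ge_zero) auto
    then show "C\<^sub>1 * t 1 powr (2 / r) * t m powr (- q - 1) \<le> near m" by (simp add: near_def mult_ac)
  qed (use assms kernel_avg_pos[OF mesh _ _ _ \<alpha>, of m m] in auto)
  finally show ?thesis unfolding avg s_def by simp
qed

lemma sum_defect_le:
  assumes "1 \<le> p" "p < m" "m \<le> M"
  shows "(\<Sum>j=p+1..m. defect m j) \<le> far m * t p powr (- q) + near m * (1 + 1 / (1 - \<alpha>)) * mesh_step t m powr (- \<alpha>)"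
proof -
  have partial: "(\<Sum>j=p+1..n. defect m j) \<le> far m * (t p powr (- q) - t n powr (- q))
     + near m * ((t m - t n) powr (- \<alpha>) - (t m - t p) powr (- \<alpha>))" if "p \<le> n" "n < m" for n
    using that
  proof (induction n rule: dec_induct)
    case (step n)
    then show ?case using defect_le[of "Suc n" m] assms by (simp add: algebra_simps)
  qed simp
  have m: "m = Suc (m - 1)" using assms by simp
  have "(\<Sum>j=p+1..m. defect m j) = (\<Sum>j=p+1..m-1. defect m j) + defect m m"
    using assms by (subst m, subst sum.nat_ivl_Suc') auto
  also have "\<dots> \<le> far m * (t p powr (- q) - t (m - 1) powr (- q))
     + near m * ((t m - t (m - 1)) powr (- \<alpha>) - (t m - t p) powr (- \<alpha>)) + near m / (1 - \<alpha>) * mesh_step t m powr (- \<alpha>)"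
    using assms by (intro add_mono partial last_defect_le) auto
  also have "\<dots> \<le> far m * t p powr (- q) + near m * mesh_step t m powr (- \<alpha>) + near m / (1 - \<alpha>) * mesh_step t m powr (- \<alpha>)"
    using near_nonneg[of m] far_nonneg[of m] \<alpha> unfolding mesh_step_def[symmetric]
    by (intro add_mono mult_left_mono) auto
  finally show ?thesis by (simp add: algebra_simps)
qed

lemma C2_nonneg: "0 \<le> C\<^sub>2"
  using C1_pos q_pos \<alpha> by (simp add: defect_const_def)

text \<open>The error relative to the gain \<open>t\<^sub>p\<^sup>\<alpha> t\<^sub>m\<^sup>-\<^sup>\<alpha>\<^sup>-\<^sup>1\<close> from the truncation. The near part is
  \<open>t\<^sub>m\<^sup>-\<^sup>1 (\<tau> / t\<^sub>m)\<^sup>e = t\<^sub>m\<^sup>-\<^sup>1 (\<tau> / t\<^sub>p)\<^sup>e (t\<^sub>p / t\<^sub>m)\<^sup>e\<close> with \<open>e = (2 - \<alpha>) / r\<close>, and lowering the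
  exponent of \<open>t\<^sub>p / t\<^sub>m \<le> 1\<close> from \<open>e\<close> to \<open>\<alpha>\<close> is where \<open>r \<le> (2 - \<alpha>) / \<alpha>\<close> enters.\<close>

lemma sum_defect_relative:
  assumes "1 \<le> p" "p < m" "m \<le> M"
  shows "(\<Sum>j=p+1..m. defect m j)
    \<le> C\<^sub>2 * (K * real p powr (- r)) powr ((2 - \<alpha>) / r) * (t p powr \<alpha> * t m powr (- \<alpha> - 1))"
proof -
  define \<tau> \<theta> x where "\<tau> = t 1" and "\<theta> = t p" and "x = t m"
  define e where "e = (2 - \<alpha>) / r"
  define G where "G = \<theta> powr \<alpha> * x powr (- \<alpha> - 1)"
  define w where "w = 1 + 1 / (1 - \<alpha>)"
  have pos: "0 < \<tau>" "0 < \<theta>" "0 < x" and ord: "\<tau> \<le> \<theta>" "\<theta> \<le> x"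
    using assms tau_pos temporal_mesh_pos[OF mesh] tau_le temporal_mesh_le[OF mesh]
    by (auto simp: \<tau>_def \<theta>_def x_def)
  have "r * \<alpha> \<le> 2 - \<alpha>" using r \<alpha> by (simp add: field_simps)
  then have e: "\<alpha> \<le> e" "e \<le> 2 / r" "0 < e" using r \<alpha> by (auto simp: e_def field_simps)
  have ratio: "(\<tau> / \<theta>) powr e \<le> (K * real p powr (- r)) powr e"
    using tau_over_node_le[of p] assms pos e by (intro powr_mono2) (auto simp: \<tau>_def \<theta>_def)
  have "far m * t p powr (- q) = 4 * C\<^sub>1 / q * ((\<tau> powr (2 / r) * \<theta> powr (- (2 / r))) * (\<theta> powr \<alpha> * x powr (- \<alpha> - 1)))"
    using pos by (simp add: far_def decay_exponent_def \<tau>_def \<theta>_def x_def powr_add[symmetric] mult.assoc)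
  also have "\<tau> powr (2 / r) * \<theta> powr (- (2 / r)) = (\<tau> / \<theta>) powr (2 / r)"
    using pos by (simp add: powr_divide powr_minus_divide)
  also have "4 * C\<^sub>1 / q * ((\<tau> / \<theta>) powr (2 / r) * (\<theta> powr \<alpha> * x powr (- \<alpha> - 1)))
     \<le> 4 * C\<^sub>1 / q * ((\<tau> / \<theta>) powr e * G)"
    unfolding G_def using e pos ord C1_pos q_pos
    by (intro mult_left_mono mult_right_mono powr_mono') auto
  finally have 1: "far m * t p powr (- q) \<le> 4 * C\<^sub>1 / q * ((\<tau> / \<theta>) powr e * G)" .
  have "\<tau> powr (1 / r) * x powr (1 - 1 / r) / K \<le> mesh_step t m"
    using le_step[of m] assms K_ge_1 by (simp add: \<tau>_def x_def field_simps)
  then have "mesh_step t m powr (- \<alpha>) \<le> (\<tau> powr (1 / r) * x powr (1 - 1 / r) / K) powr (- \<alpha>)"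
    using pos K_ge_1 \<alpha> by (intro powr_mono2') auto
  also have "\<dots> = K powr \<alpha> * (\<tau> powr (- (\<alpha> / r)) * x powr (- \<alpha> * (1 - 1 / r)))"
    using pos K_ge_1 powr_minus_divide[of K \<alpha>]
    by (simp add: powr_divide powr_mult powr_powr mult.commute)
  finally have step: "mesh_step t m powr (- \<alpha>) \<le> K powr \<alpha> * (\<tau> powr (- (\<alpha> / r)) * x powr (- \<alpha> * (1 - 1 / r)))" .
  have "near m * mesh_step t m powr (- \<alpha>)
      \<le> near m * (K powr \<alpha> * (\<tau> powr (- (\<alpha> / r)) * x powr (- \<alpha> * (1 - 1 / r))))"
    using step near_nonneg by (intro mult_left_mono) auto
  also have "\<dots> = C\<^sub>1 * 2 powr (q + 1) * K powr \<alpha> * ((\<tau> powr (2 / r) * \<tau> powr (- (\<alpha> / r)))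
       * (x powr (- q - 1) * x powr (- \<alpha> * (1 - 1 / r))))"
    by (simp add: near_def \<tau>_def x_def)
  also have "\<tau> powr (2 / r) * \<tau> powr (- (\<alpha> / r)) = \<tau> powr e"
    using pos by (simp add: powr_add[symmetric] e_def diff_divide_distrib)
  also have "x powr (- q - 1) * x powr (- \<alpha> * (1 - 1 / r)) = x powr (- e - 1)"
    using pos by (simp add: powr_add[symmetric] e_def decay_exponent_def diff_divide_distrib algebra_simps)
  also have "\<tau> powr e * x powr (- e - 1) = (\<tau> / \<theta>) powr e * ((\<theta> / x) powr e * x powr (- 1))"
    using pos by (simp add: powr_divide powr_diff powr_minus field_simps)
  also have "C\<^sub>1 * 2 powr (q + 1) * K powr \<alpha> * \<dots> \<le> C\<^sub>1 * 2 powr (q + 1) * K powr \<alpha> * ((\<tau> / \<theta>) powr e * ((\<theta> / x) powr \<alpha> * x powr (- 1)))"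
    using e pos ord C1_pos
    by (intro mult_left_mono mult_right_mono powr_mono') auto
  also have "(\<theta> / x) powr \<alpha> * x powr (- 1) = G"
    using pos by (simp add: G_def powr_divide powr_diff powr_minus field_simps)
  finally have 2: "near m * mesh_step t m powr (- \<alpha>) \<le> C\<^sub>1 * 2 powr (q + 1) * K powr \<alpha> * ((\<tau> / \<theta>) powr e * G)" .
  have "(\<Sum>j=p+1..m. defect m j) \<le> far m * t p powr (- q) + (1 + 1 / (1 - \<alpha>)) * (near m * mesh_step t m powr (- \<alpha>))"
    using sum_defect_le[OF assms] by (simp only: mult_ac)
  also have "\<dots> \<le> 4 * C\<^sub>1 / q * ((\<tau> / \<theta>) powr e * G) + (1 + 1 / (1 - \<alpha>)) * (C\<^sub>1 * 2 powr (q + 1) * K powr \<alpha> * ((\<tau> / \<theta>) powr e * G))"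
    using 1 2 \<alpha> by (intro add_mono mult_left_mono) auto
  also have "\<dots> = C\<^sub>2 * ((\<tau> / \<theta>) powr e * G)"
    unfolding defect_const_def w_def[symmetric] by (simp only: distrib_left distrib_right mult_ac)
  also have "\<dots> \<le> C\<^sub>2 * ((K * real p powr (- r)) powr e * G)"
    using ratio C2_nonneg by (intro mult_left_mono mult_right_mono) (auto simp: G_def)
  finally show ?thesis by (simp add: e_def G_def \<theta>_def x_def mult.assoc)
qed

section \<open>Discrete derivative of the truncated null function\<close>

text \<open>The factor \<open>1 / Gamma (1 - \<alpha>)\<close> of the L1 operator is left out.\<close>

definition scaled_deriv :: "nat \<Rightarrow> nat \<Rightarrow> real" where
  "scaled_deriv p m = (\<Sum>j=1..m. (barrier p j - barrier p (j - 1)) * kernel_avg \<alpha> t m j)"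

lemma L1_deriv_barrier:
  assumes "m \<le> M"
  shows "L1_deriv \<alpha> t (barrier p) m = scaled_deriv p m / Gamma (1 - \<alpha>)"
  unfolding scaled_deriv_def by (rule L1_deriv_eq_kernel_avg[OF mesh assms \<alpha>])

lemma linear_part:
  assumes "n \<le> p" "n \<le> m" "m \<le> M"
  shows "(\<Sum>j=1..n. (barrier p j - barrier p (j - 1)) * kernel_avg \<alpha> t m j)
       = t p powr (\<alpha> - 2) * ((t m powr (1 - \<alpha>) - (t m - t n) powr (1 - \<alpha>)) / (1 - \<alpha>))"
  using assms
proof (induction n)
  case 0
  then show ?case using mesh by (simp add: temporal_mesh_def)
next
  case (Suc n)
  have "mesh_step t (Suc n) > 0" using Suc by (intro mesh_step_pos[OF mesh]) auto
  then have "(barrier p (Suc n) - barrier p n) * kernel_avg \<alpha> t m (Suc n)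
     = t p powr (\<alpha> - 2) * (((t m - t n) powr (1 - \<alpha>) - (t m - t (Suc n)) powr (1 - \<alpha>)) / (1 - \<alpha>))"
    using Suc.prems by (simp add: barrier_def kernel_avg_def mesh_step_def left_diff_distrib[symmetric])
  then show ?case using Suc by (simp add: algebra_simps diff_divide_distrib)
qed

lemma scaled_deriv_before:
  assumes "m \<le> p" "m \<le> M"
  shows "scaled_deriv p m = t p powr (\<alpha> - 2) * (t m powr (1 - \<alpha>) / (1 - \<alpha>))"
  unfolding scaled_deriv_def using linear_part[of m p m] assms by simp

text \<open>The right-hand side is the exact integral of the derivative of the truncated power against the
  kernel. With \<open>\<beta> = 1 - \<alpha>\<close> and \<open>y = \<theta> / x\<close> it equals \<open>\<theta>\<^sup>\<alpha>\<^sup>-\<^sup>2 x\<^sup>\<beta>\<close> times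
  \<open>(1 - (1 - y)\<^sup>\<beta>) / \<beta> - y (1 - y)\<^sup>\<beta>\<close>. Bernoulli's inequality \<open>(1 - y)\<^sup>\<beta> \<le> 1 - \<beta> y\<close>, used in both terms,
  bounds this below by \<open>\<beta> y\<^sup>2\<close>.\<close>

lemma truncated_balance:
  fixes \<theta> x :: real
  assumes "0 < \<theta>" "\<theta> \<le> x"
  shows "(1 - \<alpha>) * (\<theta> powr \<alpha> * x powr (- \<alpha> - 1))
    \<le> \<theta> powr (\<alpha> - 2) * ((x powr (1 - \<alpha>) - (x - \<theta>) powr (1 - \<alpha>)) / (1 - \<alpha>))
      - (x - \<theta>) powr (1 - \<alpha>) * \<theta> powr (\<alpha> - 1) / x"
proof -
  define c u \<beta> where "c = x powr (1 - \<alpha>)" and "u = (x - \<theta>) powr (1 - \<alpha>)" and "\<beta> = 1 - \<alpha>"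
  have \<beta>: "0 < \<beta>" using \<alpha> by (simp add: \<beta>_def)
  have 1: "\<theta> * x powr (- \<alpha>) \<le> (c - u) / \<beta>"
    using powr_difference_lower[of "x - \<theta>" x \<alpha>] assms \<alpha> by (simp add: c_def u_def \<beta>_def)
  have "1 - \<alpha> - 1 = - \<alpha>" "1 - \<alpha> - 2 = - \<alpha> - 1" by simp_all
  moreover have "x powr (1 - \<alpha> - 1) = c / x" "x powr (1 - \<alpha> - 2) = c / x\<^sup>2"
    using assms by (simp_all only: powr_diff c_def) simp_all
  ultimately have cx: "x powr (- \<alpha>) = c / x" "x powr (- \<alpha> - 1) = c / x\<^sup>2" by (simp_all only:)
  have "u \<le> c - \<beta> * (\<theta> * c / x)" using 1 \<beta> by (simp add: cx field_simps)
  then have 2: "u * (\<theta> / x) \<le> (c - \<beta> * (\<theta> * c / x)) * (\<theta> / x)" using assms by (intro mult_right_mono) auto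
  have \<theta>: "\<theta> powr \<alpha> = \<theta> powr (\<alpha> - 2) * \<theta>\<^sup>2" "\<theta> powr (\<alpha> - 1) = \<theta> powr (\<alpha> - 2) * \<theta>"
    using assms powr_add[of \<theta> "\<alpha> - 2" 2] powr_add[of \<theta> "\<alpha> - 2" 1] by simp_all
  have "\<beta> * \<theta>\<^sup>2 * (c / x\<^sup>2) = \<theta> * (c / x) - (c - \<beta> * (\<theta> * c / x)) * (\<theta> / x)"
    using assms by (simp add: field_simps power2_eq_square)
  also have "\<dots> \<le> (c - u) / \<beta> - u * (\<theta> / x)" using 1[unfolded cx] 2 by (intro diff_mono) simp_all
  finally have "\<theta> powr (\<alpha> - 2) * (\<beta> * \<theta>\<^sup>2 * (c / x\<^sup>2)) \<le> \<theta> powr (\<alpha> - 2) * ((c - u) / \<beta> - u * (\<theta> / x))"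
    by (intro mult_left_mono) auto
  then show ?thesis unfolding c_def[symmetric] u_def[symmetric] unfolding \<beta>_def[symmetric] cx \<theta>
    by (simp add: algebra_simps)
qed

text \<open>The kink \<open>t\<^sub>p\<close> is far enough from 0, in terms of the index, for the discretization error to consume at
  most half of the gain from the truncation.\<close>

definition resolved :: "nat \<Rightarrow> bool" where
  "resolved p \<longleftrightarrow> C\<^sub>2 * (K * real p powr (- r)) powr ((2 - \<alpha>) / r) \<le> (1 - \<alpha>) / 2"

lemma scaled_deriv_after:
  assumes "resolved p" "1 \<le> p" "p \<le> m" "m \<le> M"
  shows "(1 - \<alpha>) / 2 * (t p powr \<alpha> * t m powr (- \<alpha> - 1)) \<le> scaled_deriv p m"
proof -
  define G where "G j = (t m - t j) powr (1 - \<alpha>) * t j powr (\<alpha> - 1) / t m" for j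
  have pos: "0 < t p" "t p \<le> t m"
    using assms temporal_mesh_pos[OF mesh] temporal_mesh_le[OF mesh] by auto
  have tail: "(\<Sum>j=p+1..m. defect m j) \<le> (1 - \<alpha>) / 2 * (t p powr \<alpha> * t m powr (- \<alpha> - 1))"
  proof (cases "p = m")
    case False
    then show ?thesis
      using sum_defect_relative[of p m] assms
        mult_right_mono[OF assms(1)[unfolded resolved_def], of "t p powr \<alpha> * t m powr (- \<alpha> - 1)"] by simp
  qed (use \<alpha> in simp)
  \<comment> \<open>On the part where the barrier is a pure power, the increments sum to the telescoping antiderivative minus the errors.\<close>
  have convex: "G n - G p - (\<Sum>j=p+1..n. defect m j)
      \<le> (\<Sum>j=p+1..n. (barrier p j - barrier p (j - 1)) * kernel_avg \<alpha> t m j)" if "p \<le> n" "n \<le> m" for n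
    using that
  proof (induction n rule: dec_induct)
    case (step n)
    have "barrier p n = t n powr (\<alpha> - 1)"
    proof (cases "n = p")
      case True
      then show ?thesis using pos powr_add[of "t p" 1 "\<alpha> - 2"] by (simp add: barrier_def)
    qed (use step in \<open>simp add: barrier_def\<close>)
    then have "G (Suc n) - G n - defect m (Suc n) \<le> (barrier p (Suc n) - barrier p n) * kernel_avg \<alpha> t m (Suc n)"
      using increment_over_kernel[of "Suc n" m] step assms by (simp add: G_def barrier_def)
    then show ?case using step by simp
  qed simp
  have "scaled_deriv p m = (\<Sum>j=1..p. (barrier p j - barrier p (j - 1)) * kernel_avg \<alpha> t m j)
      + (\<Sum>j=p+1..m. (barrier p j - barrier p (j - 1)) * kernel_avg \<alpha> t m j)"
    unfolding scaled_deriv_def using assms sum.ub_add_nat[of 1 p _ "m - p"] by simp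
  moreover have "G m = 0" by (simp add: G_def)
  moreover have "(1 - \<alpha>) / 2 * (t p powr \<alpha> * t m powr (- \<alpha> - 1))
      = (1 - \<alpha>) * (t p powr \<alpha> * t m powr (- \<alpha> - 1)) - (1 - \<alpha>) / 2 * (t p powr \<alpha> * t m powr (- \<alpha> - 1))"
    by (simp add: field_simps)
  ultimately show ?thesis
    using linear_part[of p p m] convex[of m] tail truncated_balance[OF pos, folded G_def] assms
    by linarith
qed

lemma scaled_deriv_nonneg:
  assumes "resolved p" "1 \<le> p" "p \<le> M" "m \<le> M"
  shows "0 \<le> scaled_deriv p m"
proof (cases "m \<le> p")
  case True
  then show ?thesis using scaled_deriv_before[of m p] assms \<alpha> by simp
next
  case False
  then show ?thesis
    using scaled_deriv_after[OF assms(1,2), of m] assms \<alpha>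
    by (smt (verit) mult_nonneg_nonneg powr_ge_zero divide_nonneg_nonneg nat_le_linear)
qed

lemma barrier_le:
  assumes "1 \<le> i" "i \<le> M" "1 \<le> p" "p \<le> M"
  shows "barrier p i \<le> t i powr (\<alpha> - 1)"
proof (cases "i \<le> p")
  case True
  have pos: "0 < t i" "t i \<le> t p" using True assms temporal_mesh_pos[OF mesh] temporal_mesh_le[OF mesh] by auto
  then have "t i * t p powr (\<alpha> - 2) \<le> t i * t i powr (\<alpha> - 2)"
    using \<alpha> by (intro mult_left_mono powr_mono2') auto
  also have "\<dots> = t i powr (\<alpha> - 1)" using pos powr_add[of "t i" 1 "\<alpha> - 2"] by simp
  finally show ?thesis using True by (simp add: barrier_def)
qed (simp add: barrier_def)

section \<open>Superposition of barriers\<close>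

text \<open>A Riemann-sum weight for the measure \<open>\<tau>\<^sup>\<gamma>\<^sup>+\<^sup>1 s\<^sup>-\<^sup>\<gamma>\<^sup>-\<^sup>1 ds\<close> on kink positions. The gain at level \<open>m\<close>
  integrates to \<open>\<tau>\<^sup>\<gamma>\<^sup>+\<^sup>1 t\<^sub>m\<^sup>-\<^sup>\<gamma>\<^sup>-\<^sup>1\<close> over kinks comparable to \<open>t\<^sub>m\<close>, which is the required size.\<close>

definition weight :: "real \<Rightarrow> nat \<Rightarrow> real" where
  "weight \<gamma> p = t 1 powr (\<gamma> + 1) * mesh_step t p * t p powr (- \<gamma> - 1)"

lemma weight_nonneg: "1 \<le> p \<Longrightarrow> p \<le> M \<Longrightarrow> 0 \<le> weight \<gamma> p"
  using mesh_step_pos[OF mesh, of p] by (simp add: weight_def)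

text \<open>The index \<open>N\<close> is the threshold beyond which kinks are resolved. The separate first barrier serves the
  levels \<open>m\<close> up to \<open>2 N\<close>, where the sum may lack the kinks with \<open>m / 2 \<le> p < N\<close>; the minimum covers meshes
  with fewer than \<open>2 N\<close> intervals.\<close>

definition superposition :: "real \<Rightarrow> nat \<Rightarrow> nat \<Rightarrow> real" where
  "superposition \<gamma> N i = t 1 * barrier (min (2 * N) M) i + (\<Sum>p=N..M. weight \<gamma> p * barrier p i)"

text \<open>The indices \<open>p \<ge> m / 2\<close> suffice: there \<open>t\<^sub>p\<close> is comparable to \<open>t\<^sub>m\<close>, each term is at least of order
  \<open>1 / m\<close> times the claimed size, and there are at least \<open>m / 2\<close> of them.\<close>

lemma sum_weights_lower:
  assumes "1 \<le> m" "m \<le> M" "1 \<le> N" "2 * N \<le> m"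
  shows "L powr (- \<bar>\<alpha> - \<gamma>\<bar>) / (2 * K powr (1 + 1 / r)) * (t 1 / t m) powr (\<gamma> + 1)
     \<le> (\<Sum>p=N..m. weight \<gamma> p * (t p powr \<alpha> * t m powr (- \<alpha> - 1)))"
proof -
  define K' where "K' = K powr (1 + 1 / r)"
  have K': "0 < K'" using K_ge_1 by (simp add: K'_def)
  define n where "n = m - m div 2"
  define c where "c = L powr (- \<bar>\<alpha> - \<gamma>\<bar>) / (real m * K') * (t 1 / t m) powr (\<gamma> + 1)"
  have pos: "0 < t 1" "0 < t m" using tau_pos temporal_mesh_pos[OF mesh] assms by auto
  have term_ge: "c \<le> weight \<gamma> p * (t p powr \<alpha> * t m powr (- \<alpha> - 1))" if p: "p \<in> {n..m}" for p
  proof -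
    have p': "1 \<le> p" "p \<le> M" "m \<le> 2 * p" "p \<le> m" using p assms by (auto simp: n_def)
    have tp: "0 < t p" "t p \<le> t m" "t m \<le> L * t p"
      using p' assms temporal_mesh_pos[OF mesh] temporal_mesh_le[OF mesh] node_ratio[of m p] by auto
    have "t p \<le> K' * real p * mesh_step t p" using node_le_step[of p] p' by (simp add: K'_def)
    also have "\<dots> \<le> K' * real m * mesh_step t p"
      using K' p' mesh_step_pos[OF mesh, of p] by (intro mult_right_mono mult_left_mono) auto
    finally have step: "t p / (real m * K') \<le> mesh_step t p"
      using assms K' by (simp add: field_simps)
    have compare: "L powr (- \<bar>\<alpha> - \<gamma>\<bar>) * t m powr (\<alpha> - \<gamma>) \<le> t p powr (\<alpha> - \<gamma>)"
    proof (cases "0 \<le> \<alpha> - \<gamma>")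
      case True
      have "(t m / L) powr (\<alpha> - \<gamma>) \<le> t p powr (\<alpha> - \<gamma>)"
        using True tp pos L_ge_1 by (intro powr_mono2) (auto simp: field_simps)
      then show ?thesis using True pos L_ge_1 powr_minus_divide[of L "\<alpha> - \<gamma>"] by (simp add: powr_divide)
    next
      case False
      have "L powr (- \<bar>\<alpha> - \<gamma>\<bar>) * t m powr (\<alpha> - \<gamma>) \<le> 1 * t m powr (\<alpha> - \<gamma>)"
        using L_ge_1 powr_mono[of "- \<bar>\<alpha> - \<gamma>\<bar>" 0 L] by (intro mult_right_mono) auto
      also have "\<dots> \<le> t p powr (\<alpha> - \<gamma>)" using False tp by (simp add: powr_mono2')
      finally show ?thesis .
    qed
    have split: "t p powr (\<alpha> - \<gamma>) = t p * (t p powr (- \<gamma> - 1) * t p powr \<alpha>)"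
      using tp powr_add[of "t p" 1 "- \<gamma> - 1 + \<alpha>"] by (simp add: powr_add[symmetric])
    have m: "t m powr (\<alpha> - \<gamma>) * t m powr (- \<alpha> - 1) = t m powr (- \<gamma> - 1)"
      using pos by (simp add: powr_add[symmetric])
    have ratio: "(t 1 / t m) powr (\<gamma> + 1) = t 1 powr (\<gamma> + 1) * t m powr (- \<gamma> - 1)"
      using pos powr_minus_divide[of "t m" "\<gamma> + 1"] by (simp add: powr_divide)
    have "c = 1 / (real m * K') * t 1 powr (\<gamma> + 1) * t m powr (- \<alpha> - 1) * (L powr (- \<bar>\<alpha> - \<gamma>\<bar>) * t m powr (\<alpha> - \<gamma>))"
      unfolding c_def ratio m[symmetric] by simp
    also have "\<dots> \<le> 1 / (real m * K') * t 1 powr (\<gamma> + 1) * t m powr (- \<alpha> - 1) * t p powr (\<alpha> - \<gamma>)"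
      using compare K' by (intro mult_left_mono) auto
    also have "\<dots> = t 1 powr (\<gamma> + 1) * (t p / (real m * K')) * t p powr (- \<gamma> - 1) * (t p powr \<alpha> * t m powr (- \<alpha> - 1))"
      unfolding split by simp
    also have "\<dots> \<le> weight \<gamma> p * (t p powr \<alpha> * t m powr (- \<alpha> - 1))"
      unfolding weight_def using step by (intro mult_right_mono mult_left_mono) auto
    finally show ?thesis .
  qed
  have c_nonneg: "0 \<le> c" using K' by (simp add: c_def)
  have "L powr (- \<bar>\<alpha> - \<gamma>\<bar>) / (2 * K powr (1 + 1 / r)) * (t 1 / t m) powr (\<gamma> + 1) = real m / 2 * c"
    using assms by (simp add: c_def K'_def)
  also have "\<dots> \<le> real (card {n..m}) * c"
    using c_nonneg assms by (intro mult_right_mono) (auto simp: n_def)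
  also have "\<dots> \<le> (\<Sum>p=n..m. weight \<gamma> p * (t p powr \<alpha> * t m powr (- \<alpha> - 1)))"
    using term_ge by (intro sum_bounded_below) auto
  also have "\<dots> \<le> (\<Sum>p=N..m. weight \<gamma> p * (t p powr \<alpha> * t m powr (- \<alpha> - 1)))"
    using assms weight_nonneg by (intro sum_mono2) (auto simp: n_def)
  finally show ?thesis .
qed

text \<open>If \<open>m \<le> 2 N\<close>, all nodes up to \<open>t\<^sub>m\<close> are comparable to \<open>\<tau>\<close> and the linear part of the first barrier has
  derivative bounded below by a constant, which is enough because \<open>\<gamma> + 1 > 0\<close>. For larger \<open>m\<close> the weighted
  sum over \<open>N \<le> p \<le> m\<close> does the work.\<close>

lemma superposition_deriv_lower:
  assumes "\<alpha> - 1 < \<gamma>" "1 \<le> N" "\<And>p. N \<le> p \<Longrightarrow> resolved p" "1 \<le> m" "m \<le> M"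
    and c: "c \<le> (K * (2 * real N) powr r) powr (\<alpha> - 2)"
      "c \<le> (1 - \<alpha>) / 2 * (L powr (- \<bar>\<alpha> - \<gamma>\<bar>) / (2 * K powr (1 + 1 / r)))" "0 \<le> c"
  shows "c / Gamma (1 - \<alpha>) * (t 1 / t m) powr (\<gamma> + 1) \<le> L1_deriv \<alpha> t (superposition \<gamma> N) m"
proof -
  define P where "P = min (2 * N) M"
  define rest where "rest = (\<Sum>p=N..M. weight \<gamma> p * scaled_deriv p m)"
  have pos: "0 < t 1" "0 < t m" "t 1 \<le> t m"
    using tau_pos temporal_mesh_pos[OF mesh] tau_le assms by auto
  have eq: "L1_deriv \<alpha> t (superposition \<gamma> N) m = (t 1 * scaled_deriv P m + rest) / Gamma (1 - \<alpha>)"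
    unfolding superposition_def[abs_def] L1_deriv_add L1_deriv_sum L1_deriv_cmult
    using assms by (simp add: L1_deriv_barrier P_def rest_def add_divide_distrib sum_divide_distrib)
  have nonneg: "0 \<le> weight \<gamma> p * scaled_deriv p m" if "p \<in> {N..M}" for p
    using that assms weight_nonneg[of p \<gamma>] scaled_deriv_nonneg[of p m] by auto
  have "c * (t 1 / t m) powr (\<gamma> + 1) \<le> t 1 * scaled_deriv P m + rest"
  proof (cases "m \<le> P")
    case True
    have P: "1 \<le> P" "P \<le> M" "P \<le> 2 * N" using assms M by (auto simp: P_def)
    have "t P \<le> K * (t 1 * real P powr r)" using P by (intro node_le)
    also have "\<dots> \<le> K * (t 1 * (2 * real N) powr r)"
      using P K_ge_1 pos r by (intro mult_left_mono powr_mono2) auto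
    finally have "(K * (2 * real N) powr r * t 1) powr (\<alpha> - 2) \<le> t P powr (\<alpha> - 2)"
      using \<alpha> temporal_mesh_pos[OF mesh, of P] P by (intro powr_mono2') (auto simp: mult_ac)
    then have tP: "(K * (2 * real N) powr r) powr (\<alpha> - 2) * t 1 powr (\<alpha> - 2) \<le> t P powr (\<alpha> - 2)"
      using K_ge_1 pos by (simp add: powr_mult)
    have "c * (t 1 / t m) powr (\<gamma> + 1) \<le> c * 1"
      using pos assms \<alpha> by (intro mult_left_mono powr_le1) auto
    also have "\<dots> \<le> (K * (2 * real N) powr r) powr (\<alpha> - 2)" using c by simp
    also have "\<dots> = t 1 * ((K * (2 * real N) powr r) powr (\<alpha> - 2) * t 1 powr (\<alpha> - 2) * t 1 powr (1 - \<alpha>))"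
      using pos powr_add[of "t 1" 1 "\<alpha> - 2"] powr_add[of "t 1" "\<alpha> - 1" "1 - \<alpha>"] by simp
    also have "\<dots> \<le> t 1 * (t P powr (\<alpha> - 2) * (t m powr (1 - \<alpha>) / (1 - \<alpha>)))"
    proof (intro mult_left_mono mult_mono tP)
      have "t 1 powr (1 - \<alpha>) \<le> t m powr (1 - \<alpha>)" using pos \<alpha> by (intro powr_mono2) auto
      also have "\<dots> \<le> t m powr (1 - \<alpha>) / (1 - \<alpha>)" using \<alpha> by (simp add: field_simps)
      finally show "t 1 powr (1 - \<alpha>) \<le> t m powr (1 - \<alpha>) / (1 - \<alpha>)" .
    qed (use pos in auto)
    also have "\<dots> = t 1 * scaled_deriv P m" using scaled_deriv_before[OF True] assms by simp
    also have "0 \<le> rest" unfolding rest_def by (intro sum_nonneg nonneg)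
    then have "t 1 * scaled_deriv P m \<le> t 1 * scaled_deriv P m + rest" by simp
    finally show ?thesis .
  next
    case False
    then have N: "2 * N < m" "P = 2 * N" using assms by (auto simp: P_def)
    have "c * (t 1 / t m) powr (\<gamma> + 1) \<le> (1 - \<alpha>) / 2 * (L powr (- \<bar>\<alpha> - \<gamma>\<bar>) / (2 * K powr (1 + 1 / r))) * (t 1 / t m) powr (\<gamma> + 1)"
      using c by (intro mult_right_mono) auto
    also have "\<dots> \<le> (1 - \<alpha>) / 2 * (\<Sum>p=N..m. weight \<gamma> p * (t p powr \<alpha> * t m powr (- \<alpha> - 1)))"
      using sum_weights_lower[of m N \<gamma>] assms N \<alpha> by (simp only: mult.assoc) (intro mult_left_mono, auto)
    also have "\<dots> = (\<Sum>p=N..m. weight \<gamma> p * ((1 - \<alpha>) / 2 * (t p powr \<alpha> * t m powr (- \<alpha> - 1))))"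
      by (simp add: sum_distrib_left mult_ac)
    also have "\<dots> \<le> (\<Sum>p=N..m. weight \<gamma> p * scaled_deriv p m)"
      using assms by (intro sum_mono mult_left_mono scaled_deriv_after weight_nonneg) auto
    also have "\<dots> \<le> rest"
      unfolding rest_def using assms nonneg by (intro sum_mono2) auto
    also have "\<dots> \<le> t 1 * scaled_deriv P m + rest"
      using scaled_deriv_nonneg[of P m] assms N pos by auto
    finally show ?thesis .
  qed
  moreover have "0 < Gamma (1 - \<alpha>)" using \<alpha> by (intro Gamma_real_pos) auto
  ultimately show ?thesis unfolding eq by (simp add: divide_right_mono)
qed

text \<open>The factor by which the claimed bound exceeds \<open>\<tau> t\<^sub>i\<^sup>\<alpha>\<^sup>-\<^sup>1\<close>.\<close>

definition profile :: "real \<Rightarrow> nat \<Rightarrow> real" where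
  "profile \<gamma> i = (if \<gamma> > 0 then 1 else if \<gamma> = 0 then 1 + ln (t i / t 1) else (t 1 / t i) powr \<gamma>)"

lemma profile_ge:
  assumes "1 \<le> i" "i \<le> M"
  shows "1 \<le> profile \<gamma> i" "(t 1 / t i) powr \<gamma> \<le> profile \<gamma> i"
proof -
  have pos: "0 < t 1" "0 < t i" "t 1 \<le> t i"
    using tau_pos temporal_mesh_pos[OF mesh] tau_le assms by auto
  have "(t 1 / t i) powr \<gamma> \<le> 1" if "0 \<le> \<gamma>" using that pos by (intro powr_le1) auto
  moreover have "1 \<le> (t 1 / t i) powr \<gamma>" if "\<gamma> < 0"
    using that pos powr_mono'[of \<gamma> 0 "t 1 / t i"] by auto
  ultimately show "1 \<le> profile \<gamma> i" "(t 1 / t i) powr \<gamma> \<le> profile \<gamma> i"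
    using pos by (auto simp: profile_def)
qed

text \<open>Up to the factor \<open>\<tau>\<^sup>\<gamma>\<^sup>+\<^sup>1\<close> the sum is at most the integral of \<open>s\<^sup>-\<^sup>\<gamma>\<^sup>-\<^sup>1\<close> from \<open>\<tau>\<close> to \<open>t\<^sub>i\<close>. It is dominated
  by its lower end for \<open>\<gamma> > 0\<close> and by its upper end for \<open>\<gamma> < 0\<close>, and is logarithmic in between.\<close>

lemma sum_weights_upper:
  assumes "- 1 \<le> \<gamma>" "1 \<le> i" "i \<le> M"
  shows "(\<Sum>p=2..i. weight \<gamma> p) \<le> (if \<gamma> = 0 then 1 else 1 / \<bar>\<gamma>\<bar>) * (t 1 * profile \<gamma> i)"
proof -
  define F where "F s = (if \<gamma> = 0 then ln s else - (s powr (- \<gamma>)) / \<gamma>)" for s :: real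
  have pos: "0 < t 1" "0 < t i" "t 1 \<le> t i"
    using tau_pos temporal_mesh_pos[OF mesh] tau_le assms by auto
  have "(\<Sum>p=2..n. weight \<gamma> p) \<le> t 1 powr (\<gamma> + 1) * (F (t n) - F (t 1))" if "1 \<le> n" "n \<le> M" for n
    using that
  proof (induction n rule: nat_induct_at_least)
    case (Suc n)
    have tn: "0 < t n" "t n < t (Suc n)" "mesh_step t (Suc n) = t (Suc n) - t n"
      using Suc temporal_mesh_pos[OF mesh] temporal_mesh_less[OF mesh] by (auto simp: mesh_step_def)
    have "mesh_step t (Suc n) * t (Suc n) powr (- \<gamma> - 1) \<le> F (t (Suc n)) - F (t n)"
      using step_times_powr_telescopes[of "t n" "t (Suc n)" \<gamma>] step_over_endpoint_le_ln[of "t n" "t (Suc n)"]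
        tn assms powr_minus_divide[of "t (Suc n)" 1]
      by (simp add: F_def diff_divide_distrib)
    then have "weight \<gamma> (Suc n) \<le> t 1 powr (\<gamma> + 1) * (F (t (Suc n)) - F (t n))"
      unfolding weight_def mult.assoc by (intro mult_left_mono) auto
    moreover have "(\<Sum>p=2..n. weight \<gamma> p) \<le> t 1 powr (\<gamma> + 1) * (F (t n) - F (t 1))" using Suc by simp
    ultimately show ?case using Suc.hyps by (simp add: algebra_simps)
  qed simp
  then have "(\<Sum>p=2..i. weight \<gamma> p) \<le> t 1 powr (\<gamma> + 1) * (F (t i) - F (t 1))" using assms by simp
  also have "\<dots> = t 1 * (t 1 powr \<gamma> * (F (t i) - F (t 1)))"
    using pos by (simp add: powr_add)
  also have "\<dots> \<le> t 1 * ((if \<gamma> = 0 then 1 else 1 / \<bar>\<gamma>\<bar>) * profile \<gamma> i)"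
  proof (rule mult_left_mono)
    consider "\<gamma> > 0" | "\<gamma> = 0" | "\<gamma> < 0" by linarith
    then show "t 1 powr \<gamma> * (F (t i) - F (t 1)) \<le> (if \<gamma> = 0 then 1 else 1 / \<bar>\<gamma>\<bar>) * profile \<gamma> i"
    proof cases
      case 1
      have "F (t i) - F (t 1) \<le> t 1 powr (- \<gamma>) / \<gamma>" using 1 by (simp add: F_def)
      then have "t 1 powr \<gamma> * (F (t i) - F (t 1)) \<le> t 1 powr \<gamma> * (t 1 powr (- \<gamma>) / \<gamma>)"
        by (intro mult_left_mono) auto
      also have "\<dots> = 1 / \<gamma>" using pos by (simp add: powr_add[symmetric])
      finally show ?thesis using 1 by (simp add: profile_def)
    next
      case 2
      then show ?thesis using pos by (simp add: F_def profile_def ln_div)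
    next
      case 3
      have "F (t i) - F (t 1) \<le> t i powr (- \<gamma>) / (- \<gamma>)" using 3 divide_nonneg_neg[of "t 1 powr (- \<gamma>)" \<gamma>] by (simp add: F_def)
      then have "t 1 powr \<gamma> * (F (t i) - F (t 1)) \<le> t 1 powr \<gamma> * (t i powr (- \<gamma>) / (- \<gamma>))"
        by (intro mult_left_mono) auto
      also have "\<dots> = (t 1 / t i) powr \<gamma> / (- \<gamma>)" using pos by (simp add: powr_divide powr_minus_divide)
      finally show ?thesis using 3 by (simp add: profile_def)
    qed
  qed (use pos in auto)
  finally show ?thesis by (simp add: mult_ac)
qed

text \<open>Barriers with their kink beyond \<open>t\<^sub>i\<close> are still linear at \<open>t\<^sub>i\<close>. Their slopes decay fast enough for the sum
  to be controlled by the first kinks after \<open>t\<^sub>i\<close>.\<close>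

lemma sum_later_weights:
  assumes "\<alpha> - 1 < \<gamma>" "1 \<le> i" "i \<le> M"
  shows "(\<Sum>p=i+1..M. weight \<gamma> p * (t i * t p powr (\<alpha> - 2))) \<le> t 1 * t i powr (\<alpha> - 1) * (t 1 / t i) powr \<gamma>"
proof -
  define e where "e = 2 - \<alpha> + \<gamma>"
  have e: "1 < e" using assms by (simp add: e_def)
  have pos: "0 < t 1" "0 < t i" using tau_pos temporal_mesh_pos[OF mesh] assms by auto
  have tail: "(\<Sum>p=i+1..n. mesh_step t p * t p powr (- e - 1)) \<le> (t i powr (- e) - t n powr (- e)) / e" if "i \<le> n" "n \<le> M" for n
    using that
  proof (induction n rule: dec_induct)
    case (step n)
    have "0 < t n" "t n < t (Suc n)" "mesh_step t (Suc n) = t (Suc n) - t n"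
      using step assms temporal_mesh_pos[OF mesh] temporal_mesh_less[OF mesh] by (auto simp: mesh_step_def)
    then have "mesh_step t (Suc n) * t (Suc n) powr (- e - 1) \<le> (t n powr (- e) - t (Suc n) powr (- e)) / e"
      using step_times_powr_telescopes[of "t n" "t (Suc n)" e] e by simp
    then show ?case using step by (simp add: diff_divide_distrib)
  qed simp
  have "(\<Sum>p=i+1..M. weight \<gamma> p * (t i * t p powr (\<alpha> - 2)))
      = t 1 powr (\<gamma> + 1) * t i * (\<Sum>p=i+1..M. mesh_step t p * t p powr (- e - 1))"
    unfolding sum_distrib_left
  proof (rule sum.cong)
    fix p assume "p \<in> {i+1..M}"
    have "t p powr (- e - 1) = t p powr (- \<gamma> - 1) * t p powr (\<alpha> - 2)"
      by (simp add: powr_add[symmetric] e_def)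
    then show "weight \<gamma> p * (t i * t p powr (\<alpha> - 2)) = t 1 powr (\<gamma> + 1) * t i * (mesh_step t p * t p powr (- e - 1))"
      by (simp add: weight_def)
  qed simp
  also have "\<dots> \<le> t 1 powr (\<gamma> + 1) * t i * t i powr (- e)"
  proof (rule mult_left_mono)
    have "(\<Sum>p=i+1..M. mesh_step t p * t p powr (- e - 1)) \<le> (t i powr (- e) - t M powr (- e)) / e"
      using tail[of M] assms by simp
    also have "\<dots> \<le> t i powr (- e) / e" using e by (intro divide_right_mono) auto
    also have "\<dots> \<le> t i powr (- e) / 1" using e by (intro divide_left_mono) auto
    finally show "(\<Sum>p=i+1..M. mesh_step t p * t p powr (- e - 1)) \<le> t i powr (- e)" by simp
  qed (use pos in auto)
  also have "\<dots> = t 1 * t i powr (\<alpha> - 1) * (t 1 / t i) powr \<gamma>"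
  proof -
    have "t i * t i powr (- e) = t i powr (1 + - e)" using pos by (subst powr_add) simp
    also have "1 + - e = (\<alpha> - 1) + - \<gamma>" by (simp add: e_def)
    finally have "t i * t i powr (- e) = t i powr (\<alpha> - 1) * t i powr (- \<gamma>)" by (simp only: powr_add)
    then show ?thesis using pos unfolding mult.assoc \<open>t i * t i powr (- e) = t i powr (\<alpha> - 1) * t i powr (- \<gamma>)\<close> by (simp add: powr_add powr_divide powr_minus_divide)
  qed
  finally show ?thesis .
qed

text \<open>The barriers with kink up to \<open>t\<^sub>i\<close> all have the value \<open>t\<^sub>i\<^sup>\<alpha>\<^sup>-\<^sup>1\<close> there and contribute it times the sum of
  their weights. The later kinks and the extra first barrier account for the 2 in the constant.\<close>

lemma superposition_upper:
  assumes "\<alpha> - 1 < \<gamma>" "2 \<le> N" "1 \<le> i" "i \<le> M"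
  shows "superposition \<gamma> N i \<le> (2 + (if \<gamma> = 0 then 1 else 1 / \<bar>\<gamma>\<bar>)) * V_bound \<alpha> \<gamma> t i"
proof -
  define A where "A = (if \<gamma> = 0 then 1 else 1 / \<bar>\<gamma>\<bar>)"
  define f where "f = t i powr (\<alpha> - 1)"
  define h where "h p = (if p \<le> i then weight \<gamma> p * f else weight \<gamma> p * (t i * t p powr (\<alpha> - 2)))" for p
  have pos: "0 < t 1" "0 < t i" "0 \<le> f" "0 \<le> A"
    using tau_pos temporal_mesh_pos[OF mesh] assms by (auto simp: f_def A_def)
  have h_ge: "weight \<gamma> p * barrier p i \<le> h p" if "1 \<le> p" "p \<le> M" for p
    using that assms barrier_le[of i p] weight_nonneg[of p \<gamma>]
    by (auto simp: h_def f_def barrier_def intro!: mult_left_mono)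
  have h_nonneg: "0 \<le> h p" if "1 \<le> p" "p \<le> M" for p
    using that pos weight_nonneg[of p \<gamma>] by (auto simp: h_def)
  have "(\<Sum>p=N..M. weight \<gamma> p * barrier p i) \<le> (\<Sum>p=N..M. h p)"
    using assms h_ge by (intro sum_mono) auto
  also have "\<dots> \<le> (\<Sum>p=2..M. h p)"
    using assms h_nonneg by (intro sum_mono2) auto
  also have "{2..M} = {2..i} \<union> {i+1..M}" using assms by auto
  also have "sum h ({2..i} \<union> {i+1..M}) = (\<Sum>p=2..i. h p) + (\<Sum>p=i+1..M. h p)"
    by (intro sum.union_disjoint) auto
  also have "(\<Sum>p=2..i. h p) = f * (\<Sum>p=2..i. weight \<gamma> p)"
    unfolding sum_distrib_left by (intro sum.cong) (auto simp: h_def)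
  also have "(\<Sum>p=i+1..M. h p) = (\<Sum>p=i+1..M. weight \<gamma> p * (t i * t p powr (\<alpha> - 2)))"
    by (intro sum.cong) (auto simp: h_def)
  also have "f * (\<Sum>p=2..i. weight \<gamma> p) + \<dots> \<le> f * (A * (t 1 * profile \<gamma> i)) + t 1 * f * (t 1 / t i) powr \<gamma>"
    using assms \<alpha> pos unfolding A_def f_def
    by (intro add_mono mult_left_mono sum_weights_upper sum_later_weights) auto
  also have "\<dots> \<le> f * (A * (t 1 * profile \<gamma> i)) + t 1 * f * profile \<gamma> i"
    using profile_ge(2)[of i \<gamma>] assms pos by (intro add_mono mult_left_mono) auto
  finally have 1: "(\<Sum>p=N..M. weight \<gamma> p * barrier p i) \<le> (A + 1) * (t 1 * f * profile \<gamma> i)"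
    by (simp add: algebra_simps)
  have "t 1 * barrier (min (2 * N) M) i \<le> t 1 * f"
    unfolding f_def using assms pos M by (intro mult_left_mono barrier_le) auto
  also have "\<dots> \<le> t 1 * f * profile \<gamma> i"
    using mult_left_mono[OF profile_ge(1)[of i \<gamma>], of "t 1 * f"] assms pos by simp
  finally have "superposition \<gamma> N i \<le> (2 + A) * (t 1 * f * profile \<gamma> i)"
    using 1 by (simp add: superposition_def algebra_simps)
  then show ?thesis by (simp add: A_def f_def V_bound_def profile_def)
qed

lemma superposition_0: "superposition \<gamma> N 0 = 0"
  using mesh by (simp add: superposition_def barrier_def temporal_mesh_def)

end

section \<open>Stability on quasi-graded meshes\<close>

lemma eventually_powr_small:
  fixes C K r e d :: real
  assumes "1 \<le> r" "0 < e" "0 < d" "0 < K"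
  obtains N :: nat where "2 \<le> N" "\<And>p. N \<le> p \<Longrightarrow> C * (K * real p powr (- r)) powr e \<le> d"
proof -
  have "(\<lambda>p. real p powr (- r)) \<longlonglongrightarrow> 0"
    using assms by (intro tendsto_neg_powr filterlim_real_sequentially) auto
  then have "(\<lambda>p. C * (K * real p powr (- r)) powr e) \<longlonglongrightarrow> C * (K * 0) powr e"
    using assms by (intro tendsto_intros) auto
  then have "\<forall>\<^sub>F p in sequentially. C * (K * real p powr (- r)) powr e < d"
    using assms by (intro order_tendstoD(2)) auto
  then obtain N where "\<And>p. N \<le> p \<Longrightarrow> C * (K * real p powr (- r)) powr e < d"
    by (auto simp: eventually_sequentially)
  then show ?thesis using that[of "max 2 N"] by (meson less_imp_le max.bounded_iff order_refl)
qed

lemma property_S_abs_graded: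
  assumes \<alpha>: "0 < \<alpha>" "\<alpha> < 1" and "0 < T" and r: "1 \<le> r" "r \<le> (2 - \<alpha>) / \<alpha>" and "K > 0" and \<gamma>: "\<alpha> - 1 < \<gamma>"
  shows "property_S_abs \<alpha> \<gamma> {(M, t). temporal_mesh T M t \<and> quasi_graded K r M t}"
proof -
  have "0 < (2 - \<alpha>) / r" "0 < (1 - \<alpha>) / 2" using \<alpha> r by auto
  from eventually_powr_small[OF r(1) this \<open>K > 0\<close>] obtain N :: nat where N: "2 \<le> N"
    "\<And>p. N \<le> p \<Longrightarrow> defect_const \<alpha> r K * (K * real p powr (- r)) powr ((2 - \<alpha>) / r) \<le> (1 - \<alpha>) / 2"
    by metis
  \<comment> \<open>The two arguments are the constants for the levels up to and beyond \<open>2 N\<close>, respectively.\<close>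
  define c where "c = min ((K * (2 * real N) powr r) powr (\<alpha> - 2))
     ((1 - \<alpha>) / 2 * (node_ratio_const r K powr (- \<bar>\<alpha> - \<gamma>\<bar>) / (2 * K powr (1 + 1 / r))))"
  have gamma: "0 < Gamma (1 - \<alpha>)" using \<alpha> by (intro Gamma_real_pos) auto
  have c: "0 < c"
    using \<alpha> \<open>K > 0\<close> N(1) by (auto simp: c_def node_ratio_const_def)
  show ?thesis
  proof (rule property_S_abs_if_barrier[OF \<alpha>, where c = "c / Gamma (1 - \<alpha>)" and D = "2 + (if \<gamma> = 0 then 1 else 1 / \<bar>\<gamma>\<bar>)"])
    fix M t assume Mt: "(M, t) \<in> {(M, t). temporal_mesh T M t \<and> quasi_graded K r M t}"
    have "M \<noteq> 0"
    proof
      assume "M = 0"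
      with Mt show False using \<open>0 < T\<close> by (simp add: temporal_mesh_def)
    qed
    then interpret graded_mesh \<alpha> T r K M t
      using Mt \<alpha> r by unfold_locales auto
    have "resolved p" if "N \<le> p" for p using N(2)[OF that] by (simp add: resolved_def)
    then have "c / Gamma (1 - \<alpha>) * (t 1 / t j) powr (\<gamma> + 1) \<le> L1_deriv \<alpha> t (superposition \<gamma> N) j \<and>
       superposition \<gamma> N j \<le> (2 + (if \<gamma> = 0 then 1 else 1 / \<bar>\<gamma>\<bar>)) * V_bound \<alpha> \<gamma> t j" if "j \<in> {1..M}" for j
      using that N(1) c \<gamma> by (intro conjI superposition_deriv_lower superposition_upper) (auto simp: c_def)
    then show "\<exists>B. B 0 = 0 \<and> (\<forall>j\<in>{1..M}. c / Gamma (1 - \<alpha>) * (t 1 / t j) powr (\<gamma> + 1) \<le> L1_deriv \<alpha> t B j \<and>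
       B j \<le> (2 + (if \<gamma> = 0 then 1 else 1 / \<bar>\<gamma>\<bar>)) * V_bound \<alpha> \<gamma> t j)"
      using superposition_0 by blast
  qed (use c gamma in \<open>auto intro: add_pos_nonneg\<close>)
qed

theorem theorem2p1:
  fixes \<alpha> T :: real
  assumes "0 < \<alpha>" and "\<alpha> < 1" and "T > 0"
  shows
    "(\<forall>r \<gamma> K. 1 \<le> r \<and> r \<le> (2 - \<alpha>) / \<alpha> \<and> K > 0 \<longrightarrow>
        property_S \<alpha> \<gamma> {(M, t). temporal_mesh T M t \<and> quasi_graded K r M t})
   \<and> (\<forall>\<gamma>. \<gamma> \<le> \<alpha> - 1 \<longrightarrow> property_S \<alpha> \<gamma> {(M, t). temporal_mesh T M t})
   \<and> (\<forall>r \<gamma> K. 1 \<le> r \<and> r \<le> (2 - \<alpha>) / \<alpha> \<and> K > 0 \<longrightarrow>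
        property_S_abs \<alpha> \<gamma> {(M, t). temporal_mesh T M t \<and> quasi_graded K r M t})
   \<and> (\<forall>\<gamma>. \<gamma> \<le> \<alpha> - 1 \<longrightarrow> property_S_abs \<alpha> \<gamma> {(M, t). temporal_mesh T M t})"
proof -
  have graded: "property_S_abs \<alpha> \<gamma> {(M, t). temporal_mesh T M t \<and> quasi_graded K r M t}"
    if "1 \<le> r" "r \<le> (2 - \<alpha>) / \<alpha>" "K > 0" for r \<gamma> K
  proof (cases "\<gamma> \<le> \<alpha> - 1")
    case True
    then show ?thesis using assms by (intro property_S_abs_arbitrary_mesh[where T = T]) auto
  qed (use assms that in \<open>intro property_S_abs_graded, auto\<close>)
  have arbitrary: "property_S_abs \<alpha> \<gamma> {(M, t). temporal_mesh T M t}" if "\<gamma> \<le> \<alpha> - 1" for \<gamma>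
    using assms that by (intro property_S_abs_arbitrary_mesh[where T = T]) auto
  have "property_S \<alpha> \<gamma> {(M, t). temporal_mesh T M t \<and> quasi_graded K r M t}"
    if "1 \<le> r" "r \<le> (2 - \<alpha>) / \<alpha>" "K > 0" for r \<gamma> K
    using assms graded[OF that] by (intro property_S_if_property_S_abs[where T = T]) auto
  moreover have "property_S \<alpha> \<gamma> {(M, t). temporal_mesh T M t}" if "\<gamma> \<le> \<alpha> - 1" for \<gamma>
    using assms arbitrary[OF that] by (intro property_S_if_property_S_abs[where T = T]) auto
  ultimately show ?thesis using graded arbitrary by blast
qed

end
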